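(* Let $\omega^{ij}=\{z^i,z^j\}$ be a nondegenerate Poisson tensor on $\mathbb{M}_n$, and let $\Phi^\alpha(z)$, $\alpha=1,\dots,n-k$, be functionally independent functions such that $\triangle^{\alpha\beta}=\{\Phi^\alpha,\Phi^\beta\}$ is invertible on $\mathbb{N}_k=\{\Phi^\alpha=0\}$, with inverse $\tilde\triangle_{\alpha\beta}$. Let $$\{A,B\}_D=\{A,B\}-\{A,\Phi^\alpha\}\tilde\triangle_{\alpha\beta}\{\Phi^\beta,B\}$$ be the Dirac bracket on $\mathbb{M}_n$, and let $\{\cdot,\cdot\}_{D(\mathbb{N})}$ be the bracket on $\mathbb{N}_k$ given by $\{A,B\}_{D(\mathbb{N})}=\partial_aA\,\omega_{\mathbf f}^{ab}\,\partial_bB$, where $$\omega_{\mathbf f}^{ab}(z^c)=\left.\left(\{z^a,z^b\}-\{z^a,\Phi^\alpha\}\tilde\triangle_{\alpha\beta}\{\Phi^\beta,z^b\}\right)\right|_{z^\alpha=f^\alpha(z^c)} .$$ Then the functions $\Phi^\alpha$ are Casimir functions of the Dirac bracket, $\{A,\Phi^\alpha\}_D=0$ for every function $A$, and $(\mathbb{N}_k,\{\cdot,\cdot\}_{D(\mathbb{N})})$ is a Poisson submanifold of $(\mathbb{M}_n,\{\cdot,\cdot\}_D)$: for all functions $A,B$ on $\mathbb{M}_n$, with restrictions $\bar A(z^a)=A(f^\alpha(z^a),z^a)$ and $\bar B(z^a)=B(f^\alpha(z^a),z^a)$, $$\left.\{A,B\}_D\right|_{z^\alpha=f^\alpha(z^a)}=\{\bar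 A,\bar B\}_{D(\mathbb{N})}.$$
   Context: All objects are smooth, and all statements are local; the Dirac bracket is considered in a neighbourhood of $\mathbb{N}_k$ where $\triangle^{\alpha\beta}$ is invertible. Repeated indices are summed. A Poisson tensor is a contravariant tensor $\omega^{ij}(z)$ with $\omega^{ij}=-\omega^{ji}$ and $\omega^{ip}\partial_p\omega^{jk}+\mathrm{cycle}(i,j,k)=0$; its Poisson bracket is $\{A,B\}=\partial_iA\,\omega^{ij}\,\partial_jB$; it is nondegenerate if $\det\omega\ne0$. Functions $\Phi^\alpha$ are functionally independent if $\operatorname{rank}(\partial_i\Phi^\alpha)=n-k$; coordinates are then grouped as $z^i=(z^\alpha,z^a)$, $a=1,\dots,k$, with $\det(\partial\Phi^\alpha/\partial z^\beta)\ne0$, so that $\Phi^\alpha=0$ can be solved as $z^\alpha=f^\alpha(z^a)$ and $z^a$ are local coordinates on $\mathbb{N}_k$. A Casimir function of a bracket is a function having vanishing bracket with all functions. *)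

theory Defs
  imports "HOL-Analysis.Analysis"
begin

definition pderiv_at :: "'n::finite \<Rightarrow> (real^'n \<Rightarrow> real) \<Rightarrow> real^'n \<Rightarrow> real" where
  "pderiv_at i F z = frechet_derivative F (at z) (axis i 1)"

text \<open>Meant for open \<open>S\<close>: there, \<open>F\<close> is of class \<open>C\<^sup>r\<^sup>+\<^sup>1\<close> iff it is differentiable with partial
  derivatives of class \<open>C\<^sup>r\<close>.\<close>

primrec Cr_on :: "nat \<Rightarrow> (real^'n::finite) set \<Rightarrow> (real^'n \<Rightarrow> real) \<Rightarrow> bool" where
  "Cr_on 0 S F \<longleftrightarrow> continuous_on S F"
| "Cr_on (Suc r) S F \<longleftrightarrow>
     (\<forall>z\<in>S. F differentiable (at z)) \<and> (\<forall>i. Cr_on r S (pderiv_at i F))"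

definition smooth_on :: "(real^'n::finite) set \<Rightarrow> (real^'n \<Rightarrow> real) \<Rightarrow> bool" where
  "smooth_on S F \<longleftrightarrow> (\<forall>r. Cr_on r S F)"

text \<open>A contravariant 2-tensor is the matrix field of its components.\<close>

definition poisson_tensor_on ::
  "(real^'n::finite) set \<Rightarrow> (real^'n \<Rightarrow> real^'n^'n) \<Rightarrow> bool" where
  "poisson_tensor_on S \<omega> \<longleftrightarrow>
     (\<forall>i j. smooth_on S (\<lambda>z. \<omega> z $ i $ j)) \<and>
     (\<forall>z\<in>S. \<forall>i j. \<omega> z $ i $ j = - \<omega> z $ j $ i) \<and>
     (\<forall>z\<in>S. \<forall>i j k.
        (\<Sum>p\<in>UNIV. \<omega> z $ i $ p * pderiv_at p (\<lambda>w. \<omega> w $ j $ k) z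
                + \<omega> z $ j $ p * pderiv_at p (\<lambda>w. \<omega> w $ k $ i) z
                + \<omega> z $ k $ p * pderiv_at p (\<lambda>w. \<omega> w $ i $ j) z) = 0)"

definition nondegenerate_on ::
  "(real^'n::finite) set \<Rightarrow> (real^'n \<Rightarrow> real^'n^'n) \<Rightarrow> bool" where
  "nondegenerate_on S \<omega> \<longleftrightarrow> (\<forall>z\<in>S. det (\<omega> z) \<noteq> 0)"

type_synonym 'n bracket =
  "(real^'n \<Rightarrow> real) \<Rightarrow> (real^'n \<Rightarrow> real) \<Rightarrow> real^'n \<Rightarrow> real"

definition tensor_bracket :: "(real^'n::finite \<Rightarrow> real^'n^'n) \<Rightarrow> 'n bracket" where
  "tensor_bracket \<omega> A B z =
     (\<Sum>i\<in>UNIV. \<Sum>j\<in>UNIV. pderiv_at i A z * \<omega> z $ i $ j * pderiv_at j B z)"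

definition poisson_bracket_on :: "(real^'n::finite) set \<Rightarrow> 'n bracket \<Rightarrow> bool" where
  "poisson_bracket_on S br \<longleftrightarrow>
     (\<exists>\<omega>. poisson_tensor_on S \<omega> \<and>
        (\<forall>A B. smooth_on S A \<longrightarrow> smooth_on S B \<longrightarrow>
           (\<forall>z\<in>S. br A B z = tensor_bracket \<omega> A B z)))"

definition casimir_on :: "(real^'n::finite) set \<Rightarrow> 'n bracket \<Rightarrow> (real^'n \<Rightarrow> real) \<Rightarrow> bool" where
  "casimir_on S br C \<longleftrightarrow> (\<forall>A. smooth_on S A \<longrightarrow> (\<forall>z\<in>S. br A C z = 0))"

definition functionally_independent_on ::
  "(real^'n::finite) set \<Rightarrow> ('m::finite \<Rightarrow> real^'n \<Rightarrow> real) \<Rightarrow> bool" where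
  "functionally_independent_on S \<Phi> \<longleftrightarrow>
     (\<forall>z\<in>S. rank ((\<chi> \<alpha> i. pderiv_at i (\<Phi> \<alpha>) z) :: real^'n^'m) = CARD('m))"

text \<open>The coordinates \<open>z\<^sup>i = (z\<^sup>\<alpha>, z\<^sup>a)\<close> are indexed by the sum type \<open>'m + 'k\<close>: \<open>Inl \<alpha>\<close> for the
  \<open>n - k\<close> dependent ones, \<open>Inr a\<close> for the \<open>k\<close> local coordinates of the submanifold.\<close>

definition coord :: "'n::finite \<Rightarrow> real^'n \<Rightarrow> real" where
  "coord i z = z $ i"

definition graph_point ::
  "('m::finite \<Rightarrow> real^'k::finite \<Rightarrow> real) \<Rightarrow> real^'k \<Rightarrow> real^('m + 'k)" where
  "graph_point f y = (\<chi> i. case i of Inl \<alpha> \<Rightarrow> f \<alpha> y | Inr a \<Rightarrow> y $ a)"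

definition constraint_matrix ::
  "(real^'n::finite \<Rightarrow> real^'n^'n) \<Rightarrow> ('m::finite \<Rightarrow> real^'n \<Rightarrow> real) \<Rightarrow> real^'n \<Rightarrow> real^'m^'m" where
  "constraint_matrix \<omega> \<Phi> z = (\<chi> \<alpha> \<beta>. tensor_bracket \<omega> (\<Phi> \<alpha>) (\<Phi> \<beta>) z)"

text \<open>\<open>matrix_inv\<close> is arbitrary at points where the constraint matrix is singular, so the Dirac
  bracket is meaningful only where that matrix is invertible.\<close>

definition dirac_bracket ::
  "(real^'n::finite \<Rightarrow> real^'n^'n) \<Rightarrow> ('m::finite \<Rightarrow> real^'n \<Rightarrow> real) \<Rightarrow> 'n bracket" where
  "dirac_bracket \<omega> \<Phi> A B z =
     tensor_bracket \<omega> A B z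
     - (\<Sum>\<alpha>\<in>UNIV. \<Sum>\<beta>\<in>UNIV.
          tensor_bracket \<omega> A (\<Phi> \<alpha>) z
          * matrix_inv (constraint_matrix \<omega> \<Phi> z) $ \<alpha> $ \<beta>
          * tensor_bracket \<omega> (\<Phi> \<beta>) B z)"

definition induced_tensor ::
  "(real^('m::finite + 'k::finite) \<Rightarrow> real^('m + 'k)^('m + 'k)) \<Rightarrow>
   ('m \<Rightarrow> real^('m + 'k) \<Rightarrow> real) \<Rightarrow> ('m \<Rightarrow> real^'k \<Rightarrow> real) \<Rightarrow> real^'k \<Rightarrow> real^'k^'k" where
  "induced_tensor \<omega> \<Phi> f y =
     (\<chi> a b. dirac_bracket \<omega> \<Phi> (coord (Inr a)) (coord (Inr b)) (graph_point f y))"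

definition induced_bracket ::
  "(real^('m::finite + 'k::finite) \<Rightarrow> real^('m + 'k)^('m + 'k)) \<Rightarrow>
   ('m \<Rightarrow> real^('m + 'k) \<Rightarrow> real) \<Rightarrow> ('m \<Rightarrow> real^'k \<Rightarrow> real) \<Rightarrow> 'k bracket" where
  "induced_bracket \<omega> \<Phi> f = tensor_bracket (induced_tensor \<omega> \<Phi> f)"

text \<open>The submanifold is the graph \<open>z\<^sup>\<alpha> = f\<^sup>\<alpha>(z\<^sup>a)\<close> over \<open>V\<close>; its functions and its bracket
  \<open>br'\<close> are expressed in the local coordinates \<open>z\<^sup>a\<close>. Both brackets have to be Poisson brackets.\<close>

definition poisson_submanifold ::
  "(real^('m::finite + 'k::finite)) set \<Rightarrow> ('m + 'k) bracket \<Rightarrow>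
   (real^'k) set \<Rightarrow> ('m \<Rightarrow> real^'k \<Rightarrow> real) \<Rightarrow> 'k bracket \<Rightarrow> bool" where
  "poisson_submanifold W br V f br' \<longleftrightarrow>
     graph_point f ` V \<subseteq> W \<and>
     poisson_bracket_on W br \<and>
     poisson_bracket_on V br' \<and>
     (\<forall>A B. smooth_on W A \<longrightarrow> smooth_on W B \<longrightarrow>
        (\<forall>y\<in>V. br A B (graph_point f y)
              = br' (\<lambda>x. A (graph_point f x)) (\<lambda>x. B (graph_point f x)) y))"

end

(* For the Jacobi identity of the Dirac bracket at a point z0, replace A by Dirac's starred variable
   A* = A - {A,Phi^alpha} D_{alpha beta} (Phi^beta - Phi^beta(z0)), where D is the inverse of the
   constraint matrix. Then {A*,B*} differs from {A,B}_D by a combination of the functions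
   Phi^beta - Phi^beta(z0), which vanish at z0 and are Casimir functions of the Dirac bracket. Hence
   {A*,{B*,C*}} and {A,{B,C}_D}_D agree at z0, and the Jacobi identity (as well as antisymmetry)
   is inherited from the original bracket.
   Because the Phi^alpha are Casimir functions, the Dirac tensor is tangent to the graph: on it, the
   component with index alpha is the component with index a contracted with the derivative of
   f^alpha along z^a. Contracting the Dirac tensor with the differential of F therefore involves
   only the derivatives of the restriction of F, which gives both the restriction formula and the
   Jacobi identity of the induced tensor. *)
theory Submission
  imports Defs
begin

subsection \<open>Partial derivatives and smooth functions\<close>

lemma pderiv_at_eq:
  assumes "(F has_derivative F') (at z)"
  shows "pderiv_at i F z = F' (axis i 1)"
  using frechet_derivative_at[OF assms] by (simp add: pderiv_at_def)

text \<open>The derivative is linear, hence fixed by its values on the axis vectors. This form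
  serves as the outer factor in the chain rule along the graph.\<close>

lemma has_derivative_pderiv_at:
  fixes F :: "real^'n::finite \<Rightarrow> real"
  assumes "F differentiable (at z)"
  shows "(F has_derivative (\<lambda>h. \<Sum>i\<in>UNIV. h $ i * pderiv_at i F z)) (at z)"
proof -
  let ?F' = "frechet_derivative F (at z)"
  have F': "(F has_derivative ?F') (at z)"
    using assms frechet_derivative_works by blast
  then have "linear ?F'"
    by (rule has_derivative_linear)
  have "?F' h = (\<Sum>i\<in>UNIV. h $ i * pderiv_at i F z)" for h
  proof -
    have "?F' h = ?F' (\<Sum>i\<in>UNIV. h $ i *\<^sub>R axis i 1)"
      using basis_expansion[of h] by (simp add: scalar_mult_eq_scaleR)
    also have "\<dots> = (\<Sum>i\<in>UNIV. h $ i * pderiv_at i F z)"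
      by (simp add: linear_sum[OF \<open>linear ?F'\<close>] linear_cmul[OF \<open>linear ?F'\<close>] pderiv_at_def)
    finally show ?thesis .
  qed
  then show ?thesis
    by (intro has_derivative_eq_rhs[OF F']) (simp add: fun_eq_iff)
qed

lemma pderiv_at_const [simp]: "pderiv_at i (\<lambda>z. c) z = 0"
  by (simp add: pderiv_at_def)

lemma differentiable_coord: "coord i differentiable (at z)"
  unfolding differentiable_def coord_def
  by (rule exI) (rule bounded_linear_imp_has_derivative[OF bounded_linear_vec_nth])

lemma pderiv_at_coord: "pderiv_at i (coord j) z = (if i = j then 1 else 0)"
proof -
  have "((\<lambda>z. z $ j) has_derivative (\<lambda>h. h $ j)) (at z)"
    by (rule bounded_linear_imp_has_derivative[OF bounded_linear_vec_nth])
  from pderiv_at_eq[OF this] show ?thesis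
    by (simp add: coord_def[abs_def] axis_def)
qed

lemma pderiv_at_add:
  assumes "F differentiable (at z)" "G differentiable (at z)"
  shows "pderiv_at i (\<lambda>z. F z + G z) z = pderiv_at i F z + pderiv_at i G z"
  using assms
  by (subst pderiv_at_eq[OF has_derivative_add[OF
        frechet_derivative_works[THEN iffD1] frechet_derivative_works[THEN iffD1]]])
    (auto simp: pderiv_at_def)

lemma pderiv_at_mult:
  assumes "F differentiable (at z)" "G differentiable (at z)"
  shows "pderiv_at i (\<lambda>z. F z * G z) z = F z * pderiv_at i G z + pderiv_at i F z * G z"
  using assms
  by (subst pderiv_at_eq[OF has_derivative_mult[OF
        frechet_derivative_works[THEN iffD1] frechet_derivative_works[THEN iffD1]]])
    (auto simp: pderiv_at_def)

lemma pderiv_at_sum: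
  assumes "\<And>a. a \<in> I \<Longrightarrow> F a differentiable (at z)"
  shows "pderiv_at i (\<lambda>z. \<Sum>a\<in>I. F a z) z = (\<Sum>a\<in>I. pderiv_at i (F a) z)"
proof -
  have "((\<lambda>z. \<Sum>a\<in>I. F a z) has_derivative (\<lambda>h. \<Sum>a\<in>I. frechet_derivative (F a) (at z) h)) (at z)"
    using assms by (intro has_derivative_sum) (simp add: frechet_derivative_works)
  from pderiv_at_eq[OF this] show ?thesis
    by (simp add: pderiv_at_def)
qed

lemma pderiv_at_inverse:
  assumes "F differentiable (at z)" "F z \<noteq> 0"
  shows "pderiv_at i (\<lambda>z. inverse (F z)) z = - (inverse (F z) * pderiv_at i F z * inverse (F z))"
proof -
  have "(F has_derivative frechet_derivative F (at z)) (at z)"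
    using assms(1) by (simp add: frechet_derivative_works)
  from pderiv_at_eq[OF Deriv.has_derivative_inverse[OF assms(2) this]] show ?thesis
    by (simp add: pderiv_at_def)
qed

lemma pderiv_at_cong:
  assumes "open S" "z \<in> S" "\<And>w. w \<in> S \<Longrightarrow> F w = G w"
  shows "pderiv_at i F z = pderiv_at i G z"
proof -
  \<comment> \<open>Both functions have the same set of derivatives at \<open>z\<close>, so the
    choice in \<open>frechet_derivative\<close> picks the same one, also where that set is
    empty.\<close>
  have "(F has_derivative D) (at z) \<longleftrightarrow> (G has_derivative D) (at z)" for D
    using assms has_derivative_transform_within_open by metis
  then show ?thesis
    by (simp add: pderiv_at_def frechet_derivative_def)
qed

lemma differentiable_cong_open:
  assumes "F differentiable (at z)" "open S" "z \<in> S" "\<And>w. w \<in> S \<Longrightarrow> F w = G w"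
  shows "G differentiable (at z)"
  using assms has_derivative_transform_within_open unfolding differentiable_def by metis

section \<open>Closure properties of the classes C^r and of smooth functions\<close>

lemma Cr_on_cong:
  assumes "open S" "Cr_on r S F" "\<And>z. z \<in> S \<Longrightarrow> F z = G z"
  shows "Cr_on r S G"
  using assms(2,3)
proof (induction r arbitrary: F G)
  case 0
  then show ?case by (auto cong: continuous_on_cong)
next
  case (Suc r)
  have "Cr_on r S (pderiv_at i G)" for i
  proof (rule Suc.IH)
    show "Cr_on r S (pderiv_at i F)" using Suc.prems by simp
    show "pderiv_at i F z = pderiv_at i G z" if "z \<in> S" for z
      using Suc.prems(2) by (rule pderiv_at_cong[OF assms(1) that])
  qed
  moreover have "G differentiable (at z)" if "z \<in> S" for z
    by (rule differentiable_cong_open[OF _ assms(1) that, of F]) (use Suc.prems that in auto)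
  ultimately show ?case by simp
qed

lemma Cr_on_SucD:
  assumes "Cr_on (Suc r) S F"
  shows "Cr_on r S F"
  using assms
proof (induction r arbitrary: F)
  case 0
  then show ?case
    by (auto intro!: continuous_at_imp_continuous_on differentiable_imp_continuous_within)
qed auto

lemma Cr_on_const:
  fixes S :: "(real^'n::finite) set"
  shows "Cr_on r S (\<lambda>z. c)"
proof (induction r arbitrary: c)
  case (Suc r)
  have "pderiv_at i (\<lambda>z. c) = (\<lambda>z. 0)" for i :: 'n and c
    by (simp add: fun_eq_iff)
  then show ?case using Suc by auto
qed auto

lemma Cr_on_coord:
  fixes S :: "(real^'n::finite) set"
  shows "Cr_on r S (coord j)"
proof (cases r)
  case 0
  then show ?thesis by (auto simp: coord_def[abs_def] intro: continuous_intros)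
next
  case (Suc r)
  have "pderiv_at i (coord j) = (\<lambda>z. if i = j then 1 else 0)" for i :: 'n
    by (simp add: fun_eq_iff pderiv_at_coord)
  then show ?thesis by (auto simp: Suc differentiable_coord Cr_on_const)
qed

lemma Cr_on_add:
  assumes "open S" "Cr_on r S F" "Cr_on r S G"
  shows "Cr_on r S (\<lambda>z. F z + G z)"
  using assms(2,3)
proof (induction r arbitrary: F G)
  case 0
  then show ?case by (auto intro: continuous_intros)
next
  case (Suc r)
  have "Cr_on r S (pderiv_at i (\<lambda>z. F z + G z))" for i
    by (rule Cr_on_cong[OF assms(1) Suc.IH[of "pderiv_at i F" "pderiv_at i G"]])
      (use Suc.prems in \<open>auto simp: pderiv_at_add\<close>)
  then show ?case using Suc.prems by (auto intro: differentiable_add)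
qed

text \<open>The product rule is an identity at points of \<open>S\<close> only, so
  \<open>Cr_on_cong\<close> transfers the class from its right side to the partial derivative. The
  undifferentiated factors have one class to spare, which \<open>Cr_on_SucD\<close> gives
  up.\<close>

lemma Cr_on_mult:
  assumes "open S" "Cr_on r S F" "Cr_on r S G"
  shows "Cr_on r S (\<lambda>z. F z * G z)"
  using assms(2,3)
proof (induction r arbitrary: F G)
  case 0
  then show ?case by (auto intro: continuous_intros)
next
  case (Suc r)
  have "Cr_on r S (pderiv_at i (\<lambda>z. F z * G z))" for i
  proof (rule Cr_on_cong[OF assms(1)])
    show "Cr_on r S (\<lambda>z. F z * pderiv_at i G z + pderiv_at i F z * G z)"
      using Suc.prems
      by (intro Cr_on_add assms Suc.IH) (auto intro: Cr_on_SucD)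
  qed (use Suc.prems in \<open>auto simp: pderiv_at_mult\<close>)
  then show ?case using Suc.prems by (auto intro: differentiable_mult)
qed

text \<open>The derivative of 1/F is a product of the derivative of F with two factors 1/F, and
  these have class \<open>r\<close> by the induction hypothesis for the same F.\<close>

lemma Cr_on_inverse:
  assumes "open S" "Cr_on r S F" "\<And>z. z \<in> S \<Longrightarrow> F z \<noteq> 0"
  shows "Cr_on r S (\<lambda>z. inverse (F z))"
  using assms(2)
proof (induction r)
  case 0
  then show ?case using assms(3) by (auto intro: continuous_intros)
next
  case (Suc r)
  have "Cr_on r S (\<lambda>z. inverse (F z))"
    using Suc.IH Cr_on_SucD[OF Suc.prems] by blast
  then have "Cr_on r S (\<lambda>z. (- 1) * (inverse (F z) * pderiv_at i F z * inverse (F z)))" for i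
    using Suc.prems by (intro Cr_on_mult assms Cr_on_const) auto
  then have "Cr_on r S (pderiv_at i (\<lambda>z. inverse (F z)))" for i
    by (rule Cr_on_cong[OF assms(1)]) (use Suc.prems assms(3) in \<open>auto simp: pderiv_at_inverse\<close>)
  then show ?case using Suc.prems assms(3) by (auto intro: differentiable_inverse)
qed

lemma smooth_on_cong:
  "open S \<Longrightarrow> smooth_on S F \<Longrightarrow> (\<And>z. z \<in> S \<Longrightarrow> F z = G z) \<Longrightarrow> smooth_on S G"
  unfolding smooth_on_def by (blast intro: Cr_on_cong)

lemma smooth_on_const [simp, intro]: "smooth_on S (\<lambda>z. c)"
  by (simp add: smooth_on_def Cr_on_const)

lemma smooth_on_coord [simp, intro]: "smooth_on S (coord i)"
  by (simp add: smooth_on_def Cr_on_coord)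

lemma smooth_on_add:
  "open S \<Longrightarrow> smooth_on S F \<Longrightarrow> smooth_on S G \<Longrightarrow> smooth_on S (\<lambda>z. F z + G z)"
  by (simp add: smooth_on_def Cr_on_add)

lemma smooth_on_mult:
  "open S \<Longrightarrow> smooth_on S F \<Longrightarrow> smooth_on S G \<Longrightarrow> smooth_on S (\<lambda>z. F z * G z)"
  by (simp add: smooth_on_def Cr_on_mult)

lemma smooth_on_inverse:
  "open S \<Longrightarrow> smooth_on S F \<Longrightarrow> (\<And>z. z \<in> S \<Longrightarrow> F z \<noteq> 0) \<Longrightarrow> smooth_on S (\<lambda>z. inverse (F z))"
  by (simp add: smooth_on_def Cr_on_inverse)

lemma smooth_on_diff:
  assumes "open S" "smooth_on S F" "smooth_on S G"
  shows "smooth_on S (\<lambda>z. F z - G z)"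
proof -
  have "smooth_on S (\<lambda>z. F z + (- 1) * G z)"
    by (intro smooth_on_add smooth_on_mult assms smooth_on_const)
  then show ?thesis by simp
qed

lemma smooth_on_sum:
  assumes "open S" "\<And>a. a \<in> I \<Longrightarrow> smooth_on S (F a)"
  shows "smooth_on S (\<lambda>z. \<Sum>a\<in>I. F a z)"
  using assms(2)
  by (induction I rule: infinite_finite_induct) (auto intro: smooth_on_add assms(1))

lemma smooth_on_prod:
  assumes "open S" "\<And>a. a \<in> I \<Longrightarrow> smooth_on S (F a)"
  shows "smooth_on S (\<lambda>z. \<Prod>a\<in>I. F a z)"
  using assms(2)
  by (induction I rule: infinite_finite_induct) (auto intro: smooth_on_mult assms(1))

lemma smooth_on_differentiable: "smooth_on S F \<Longrightarrow> z \<in> S \<Longrightarrow> F differentiable (at z)"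
  unfolding smooth_on_def by (metis Cr_on.simps(2))

lemma smooth_on_pderiv_at: "smooth_on S F \<Longrightarrow> smooth_on S (pderiv_at i F)"
  unfolding smooth_on_def by (metis Cr_on.simps(2))

lemma Cr_on_subset: "Cr_on r S F \<Longrightarrow> T \<subseteq> S \<Longrightarrow> Cr_on r T F"
  by (induction r arbitrary: F) (auto intro: continuous_on_subset)

lemma smooth_on_subset: "smooth_on S F \<Longrightarrow> T \<subseteq> S \<Longrightarrow> smooth_on T F"
  unfolding smooth_on_def by (blast intro: Cr_on_subset)

section \<open>Smoothness of determinants and of inverse matrices\<close>

lemma smooth_on_det:
  fixes A :: "real^'n::finite \<Rightarrow> real^'m^'m"
  assumes "open S" "\<And>i j. smooth_on S (\<lambda>z. A z $ i $ j)"
  shows "smooth_on S (\<lambda>z. det (A z))"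
  unfolding det_def
  by (intro smooth_on_sum smooth_on_mult smooth_on_prod smooth_on_const assms)

text \<open>Cramer's rule for the system whose solution is column \<open>j\<close> of the inverse.
  It turns the choice-based \<open>matrix_inv\<close> into a rational expression in the entries,
  from which smoothness can be read off.\<close>

lemma matrix_inv_cramer:
  fixes A :: "real^'m^'m"
  assumes "invertible A"
  shows "matrix_inv A $ i $ j = inverse (det A) * det (\<chi> k l. if l = i then mat 1 $ k $ j else A $ k $ l)"
proof -
  have inv: "A ** matrix_inv A = mat 1"
    using assms unfolding invertible_def matrix_inv_def by (rule someI2_ex) auto
  have "A *v column j (matrix_inv A) = column j (mat 1)"
    unfolding inv[symmetric] by (simp add: vec_eq_iff column_def matrix_vector_mult_def matrix_matrix_mult_def)
  moreover have "det A \<noteq> 0"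
    using assms invertible_det_nz by blast
  ultimately have "column j (matrix_inv A) =
      (\<chi> i. det (\<chi> k l. if l = i then column j (mat 1) $ k else A $ k $ l) / det A)"
    using cramer by blast
  then have "column j (matrix_inv A) $ i =
      det (\<chi> k l. if l = i then column j (mat 1) $ k else A $ k $ l) / det A"
    by simp
  then show ?thesis
    unfolding column_def vec_lambda_beta by (simp add: divide_inverse mult.commute)
qed

lemma smooth_on_matrix_inv:
  fixes A :: "real^'n::finite \<Rightarrow> real^'m::finite^'m"
  assumes "open S" "\<And>i j. smooth_on S (\<lambda>z. A z $ i $ j)" "\<And>z. z \<in> S \<Longrightarrow> invertible (A z)"
  shows "smooth_on S (\<lambda>z. matrix_inv (A z) $ i $ j)"
proof (rule smooth_on_cong[OF assms(1)])
  \<comment> \<open>Entries of the matrix in Cramer's rule are constants in the replaced column and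
    entries of \<open>A\<close> elsewhere.\<close>
  have "smooth_on S (\<lambda>z. if l = i then mat 1 $ k $ j else A z $ k $ l)" for k l
    using assms(2) by (cases "l = i") auto
  then show "smooth_on S (\<lambda>z. inverse (det (A z)) *
      det (\<chi> k l. if l = i then mat 1 $ k $ j else A z $ k $ l))"
    using assms
    by (intro smooth_on_mult smooth_on_inverse smooth_on_det) (auto simp: invertible_det_nz)
qed (simp add: matrix_inv_cramer assms(3))

section \<open>Symmetry of second partial derivatives\<close>

lemma has_derivative_along_axis:
  assumes "F differentiable (at (w + s *\<^sub>R axis i 1))"
  shows "((\<lambda>s. F (w + s *\<^sub>R axis i 1)) has_real_derivative pderiv_at i F (w + s *\<^sub>R axis i 1)) (at s)"
proof -
  let ?g = "\<lambda>s. w + s *\<^sub>R axis i 1" and ?F' = "frechet_derivative F (at (w + s *\<^sub>R axis i 1))"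
  have F': "(F has_derivative ?F') (at (?g s))"
    using assms frechet_derivative_works by blast
  have "(?g has_derivative (\<lambda>h. h *\<^sub>R axis i 1)) (at s)"
    by (auto intro!: derivative_eq_intros)
  from diff_chain_at[OF this F']
  show ?thesis
    unfolding has_field_derivative_def o_def
    by (rule has_derivative_eq_rhs)
      (simp add: fun_eq_iff pderiv_at_def linear_cmul[OF has_derivative_linear[OF F']])
qed

text \<open>The mean value theorem is used twice: along axis \<open>i\<close> for the increment of
  \<open>F\<close> in direction \<open>j\<close>, then along axis \<open>j\<close> for the resulting
  partial derivative. The left side is symmetric in \<open>i\<close> and \<open>j\<close>, which is
  the point of the formula.\<close>

lemma second_difference_mvt:
  assumes "t > 0"
    and F: "\<And>s r. 0 \<le> s \<Longrightarrow> s \<le> t \<Longrightarrow> 0 \<le> r \<Longrightarrow> r \<le> t \<Longrightarrow>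
      F differentiable (at (z + s *\<^sub>R axis i 1 + r *\<^sub>R axis j 1))"
    and F': "\<And>s r. 0 \<le> s \<Longrightarrow> s \<le> t \<Longrightarrow> 0 \<le> r \<Longrightarrow> r \<le> t \<Longrightarrow>
      pderiv_at i F differentiable (at (z + s *\<^sub>R axis i 1 + r *\<^sub>R axis j 1))"
  shows "\<exists>s r. 0 < s \<and> s < t \<and> 0 < r \<and> r < t \<and>
    F (z + t *\<^sub>R axis i 1 + t *\<^sub>R axis j 1) - F (z + t *\<^sub>R axis i 1) - F (z + t *\<^sub>R axis j 1) + F z
    = t * t * pderiv_at j (pderiv_at i F) (z + s *\<^sub>R axis i 1 + r *\<^sub>R axis j 1)"
proof -
  let ?e = "axis i 1 :: real^'a" and ?d = "axis j 1 :: real^'a"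
  define \<phi> where "\<phi> s = F ((z + t *\<^sub>R ?d) + s *\<^sub>R ?e) - F (z + s *\<^sub>R ?e)" for s
  have "(\<phi> has_real_derivative
      (pderiv_at i F ((z + t *\<^sub>R ?d) + s *\<^sub>R ?e) - pderiv_at i F (z + s *\<^sub>R ?e))) (at s)"
    if "0 \<le> s" "s \<le> t" for s
    unfolding \<phi>_def
  proof (rule DERIV_diff; rule has_derivative_along_axis)
    show "F differentiable (at ((z + t *\<^sub>R ?d) + s *\<^sub>R ?e))"
      using F[of s t] that assms(1) by (simp add: ac_simps)
    show "F differentiable (at (z + s *\<^sub>R ?e))"
      using F[of s 0] that assms(1) by simp
  qed
  from MVT2[OF assms(1) this] obtain s where s: "0 < s" "s < t"
    and "\<phi> t - \<phi> 0 = (t - 0) * (pderiv_at i F ((z + t *\<^sub>R ?d) + s *\<^sub>R ?e) - pderiv_at i F (z + s *\<^sub>R ?e))"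
    by blast
  moreover have "(z + t *\<^sub>R ?d) + s *\<^sub>R ?e = z + s *\<^sub>R ?e + t *\<^sub>R ?d" "z + s *\<^sub>R ?e = z + s *\<^sub>R ?e + 0 *\<^sub>R ?d"
    by simp_all
  ultimately have 1: "\<phi> t - \<phi> 0 = t * (pderiv_at i F (z + s *\<^sub>R ?e + t *\<^sub>R ?d) - pderiv_at i F (z + s *\<^sub>R ?e + 0 *\<^sub>R ?d))"
    by (metis diff_zero)
  have "((\<lambda>r. pderiv_at i F ((z + s *\<^sub>R ?e) + r *\<^sub>R ?d)) has_real_derivative
      pderiv_at j (pderiv_at i F) ((z + s *\<^sub>R ?e) + r *\<^sub>R ?d)) (at r)"
    if "0 \<le> r" "r \<le> t" for r
    by (rule has_derivative_along_axis) (use F'[of s r] that s in auto)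
  from MVT2[OF assms(1) this] obtain r where r: "0 < r" "r < t"
    and 2: "pderiv_at i F (z + s *\<^sub>R ?e + t *\<^sub>R ?d) - pderiv_at i F (z + s *\<^sub>R ?e + 0 *\<^sub>R ?d)
      = (t - 0) * pderiv_at j (pderiv_at i F) ((z + s *\<^sub>R ?e) + r *\<^sub>R ?d)"
    by blast
  have "\<phi> t - \<phi> 0 = t * t * pderiv_at j (pderiv_at i F) (z + s *\<^sub>R ?e + r *\<^sub>R ?d)"
    using 1 unfolding 2 by (simp only: diff_zero mult.assoc)
  moreover have "\<phi> t - \<phi> 0 =
      F (z + t *\<^sub>R ?e + t *\<^sub>R ?d) - F (z + t *\<^sub>R ?e) - F (z + t *\<^sub>R ?d) + F z"
    unfolding \<phi>_def by (simp add: ac_simps)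
  ultimately show ?thesis
    using s r by metis
qed

text \<open>The symmetric second difference over a small square equals \<open>t * t\<close> times
  either mixed derivative, each at its own point of the square. So the two mixed derivatives share a
  value arbitrarily near \<open>z\<close>, and continuity of both excludes a gap at
  \<open>z\<close>.\<close>

lemma pderiv_at_commute:
  assumes "open S" "z \<in> S" "smooth_on S F"
  shows "pderiv_at i (pderiv_at j F) z = pderiv_at j (pderiv_at i F) z"
proof (rule ccontr)
  let ?e = "axis i 1 :: real^'a" and ?d = "axis j 1 :: real^'a"
  let ?G = "pderiv_at i (pderiv_at j F)" and ?H = "pderiv_at j (pderiv_at i F)"
  assume "?G z \<noteq> ?H z"
  define \<epsilon> where "\<epsilon> = \<bar>?G z - ?H z\<bar> / 2"
  have "\<epsilon> > 0" using \<open>?G z \<noteq> ?H z\<close> by (simp add: \<epsilon>_def)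
  have ball: "\<exists>\<delta>>0. \<forall>w. dist w z < \<delta> \<longrightarrow> \<bar>K w - K z\<bar> < \<epsilon>" if "smooth_on S K" for K
  proof -
    have "isCont K z"
      using that assms(2) smooth_on_differentiable differentiable_imp_continuous_within by blast
    then show ?thesis
      using \<open>\<epsilon> > 0\<close> by (simp add: continuous_at_eps_delta dist_real_def)
  qed
  obtain \<delta>1 where \<delta>1: "\<delta>1 > 0" "\<And>w. dist w z < \<delta>1 \<Longrightarrow> \<bar>?G w - ?G z\<bar> < \<epsilon>"
    using ball[OF smooth_on_pderiv_at[OF smooth_on_pderiv_at[OF assms(3)]]] by blast
  obtain \<delta>2 where \<delta>2: "\<delta>2 > 0" "\<And>w. dist w z < \<delta>2 \<Longrightarrow> \<bar>?H w - ?H z\<bar> < \<epsilon>"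
    using ball[OF smooth_on_pderiv_at[OF smooth_on_pderiv_at[OF assms(3)]]] by blast
  obtain \<delta>3 where \<delta>3: "\<delta>3 > 0" "\<And>w. dist w z < \<delta>3 \<Longrightarrow> w \<in> S"
    using assms(1,2) unfolding open_dist by blast
  \<comment> \<open>Points of the square of side \<open>t\<close> are within 2 * \<open>t\<close> of
    \<open>z\<close>; the divisor 3 puts this below all three radii.\<close>
  define t where "t = min \<delta>1 (min \<delta>2 \<delta>3) / 3"
  have "t > 0" using \<delta>1 \<delta>2 \<delta>3 by (simp add: t_def)
  have dist: "dist (z + s *\<^sub>R axis k 1 + r *\<^sub>R axis l 1) z < min \<delta>1 (min \<delta>2 \<delta>3)"
    if "0 \<le> s" "s \<le> t" "0 \<le> r" "r \<le> t" for s r k l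
  proof -
    have "dist (z + s *\<^sub>R axis k 1 + r *\<^sub>R axis l 1) z \<le> norm (s *\<^sub>R axis k (1::real)) + norm (r *\<^sub>R axis l (1::real))"
      using norm_triangle_ineq[of "s *\<^sub>R axis k (1::real)" "r *\<^sub>R axis l 1"]
      by (simp add: dist_norm algebra_simps)
    also have "\<dots> \<le> 2 * t" using that by simp
    also have "\<dots> < min \<delta>1 (min \<delta>2 \<delta>3)" using \<open>t > 0\<close> unfolding t_def by linarith
    finally show ?thesis .
  qed
  have diff: "F differentiable (at (z + s *\<^sub>R axis k 1 + r *\<^sub>R axis l 1))"
    "pderiv_at k F differentiable (at (z + s *\<^sub>R axis k 1 + r *\<^sub>R axis l 1))"
    if "0 \<le> s" "s \<le> t" "0 \<le> r" "r \<le> t" for s r k l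
  proof -
    have "z + s *\<^sub>R axis k 1 + r *\<^sub>R axis l 1 \<in> S"
      by (rule \<delta>3(2)) (use dist[OF that, of k l] in simp)
    then show "F differentiable (at (z + s *\<^sub>R axis k 1 + r *\<^sub>R axis l 1))"
      "pderiv_at k F differentiable (at (z + s *\<^sub>R axis k 1 + r *\<^sub>R axis l 1))"
      using smooth_on_differentiable[OF assms(3)]
        smooth_on_differentiable[OF smooth_on_pderiv_at[OF assms(3)]] by blast+
  qed
  have mvt: "\<exists>s r. 0 < s \<and> s < t \<and> 0 < r \<and> r < t \<and>
      F (z + t *\<^sub>R axis k 1 + t *\<^sub>R axis l 1) - F (z + t *\<^sub>R axis k 1) - F (z + t *\<^sub>R axis l 1) + F z
      = t * t * pderiv_at l (pderiv_at k F) (z + s *\<^sub>R axis k 1 + r *\<^sub>R axis l 1)" for k l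
    by (rule second_difference_mvt[OF \<open>t > 0\<close>]) (rule diff; assumption)+
  obtain s r where sr: "0 < s" "s < t" "0 < r" "r < t"
    and 1: "F (z + t *\<^sub>R ?e + t *\<^sub>R ?d) - F (z + t *\<^sub>R ?e) - F (z + t *\<^sub>R ?d) + F z
      = t * t * ?H (z + s *\<^sub>R ?e + r *\<^sub>R ?d)"
    using mvt[of i j] by blast
  obtain s' r' where sr': "0 < s'" "s' < t" "0 < r'" "r' < t"
    and 2: "F (z + t *\<^sub>R ?d + t *\<^sub>R ?e) - F (z + t *\<^sub>R ?d) - F (z + t *\<^sub>R ?e) + F z
      = t * t * ?G (z + s' *\<^sub>R ?d + r' *\<^sub>R ?e)"
    using mvt[of j i] by blast
  have "z + t *\<^sub>R ?e + t *\<^sub>R ?d = z + t *\<^sub>R ?d + t *\<^sub>R ?e" by (simp add: algebra_simps)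
  then have "F (z + t *\<^sub>R ?e + t *\<^sub>R ?d) = F (z + t *\<^sub>R ?d + t *\<^sub>R ?e)"
    by (rule arg_cong)
  with 1 2 have "t * t * ?H (z + s *\<^sub>R ?e + r *\<^sub>R ?d) = t * t * ?G (z + s' *\<^sub>R ?d + r' *\<^sub>R ?e)"
    by linarith
  then have "?H (z + s *\<^sub>R ?e + r *\<^sub>R ?d) = ?G (z + s' *\<^sub>R ?d + r' *\<^sub>R ?e)"
    using \<open>t > 0\<close> by simp
  moreover have "\<bar>?H (z + s *\<^sub>R ?e + r *\<^sub>R ?d) - ?H z\<bar> < \<epsilon>"
    by (rule \<delta>2(2)) (use dist[of s r i j] sr in simp)
  moreover have "\<bar>?G (z + s' *\<^sub>R ?d + r' *\<^sub>R ?e) - ?G z\<bar> < \<epsilon>"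
    by (rule \<delta>1(2)) (use dist[of s' r' j i] sr' in simp)
  ultimately show False
    by (simp add: \<epsilon>_def abs_if field_simps split: if_splits)
qed

subsection \<open>Brackets of contravariant tensors\<close>

lemma tensor_bracket_right_expansion:
  "tensor_bracket \<omega> A B z = (\<Sum>j\<in>UNIV. tensor_bracket \<omega> A (coord j) z * pderiv_at j B z)"
  unfolding tensor_bracket_def
  by (subst sum.swap)
    (simp add: pderiv_at_coord if_distrib[of "\<lambda>x. _ * x"] sum.delta sum_distrib_right cong: if_cong)

lemma tensor_bracket_coord_left:
  "tensor_bracket \<omega> (coord i) B z = (\<Sum>j\<in>UNIV. \<omega> z $ i $ j * pderiv_at j B z)"
  unfolding tensor_bracket_def
  by (subst sum.swap)
    (simp add: pderiv_at_coord if_distrib[of "\<lambda>x. x * _"] sum.delta cong: if_cong)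

lemma tensor_bracket_left_expansion:
  "tensor_bracket \<omega> A B z = (\<Sum>i\<in>UNIV. pderiv_at i A z * tensor_bracket \<omega> (coord i) B z)"
  unfolding tensor_bracket_coord_left by (simp add: tensor_bracket_def sum_distrib_left mult.assoc)

lemma tensor_bracket_coord_coord: "tensor_bracket \<omega> (coord i) (coord j) z = \<omega> z $ i $ j"
  by (simp add: tensor_bracket_coord_left pderiv_at_coord if_distrib[of "\<lambda>x. _ * x"] sum.delta
      cong: if_cong)

lemma tensor_bracket_antisym:
  assumes "\<And>i j. \<omega> z $ i $ j = - \<omega> z $ j $ i"
  shows "tensor_bracket \<omega> A B z = - tensor_bracket \<omega> B A z"
proof -
  have "tensor_bracket \<omega> A B z = (\<Sum>i\<in>UNIV. \<Sum>j\<in>UNIV. - (pderiv_at j B z * \<omega> z $ j $ i * pderiv_at i A z))"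
    unfolding tensor_bracket_def
    by (intro sum.cong refl) (subst assms, simp add: mult.commute mult.left_commute)
  also have "\<dots> = - tensor_bracket \<omega> B A z"
    unfolding tensor_bracket_def by (subst sum.swap) (simp add: sum_negf)
  finally show ?thesis .
qed

lemma tensor_bracket_cong_right:
  assumes "open S" "z \<in> S" "\<And>w. w \<in> S \<Longrightarrow> B w = B' w"
  shows "tensor_bracket \<omega> A B z = tensor_bracket \<omega> A B' z"
  unfolding tensor_bracket_def using pderiv_at_cong[OF assms] by simp

lemma smooth_on_tensor_bracket:
  assumes "open S" "\<And>i j. smooth_on S (\<lambda>z. \<omega> z $ i $ j)" "smooth_on S A" "smooth_on S B"
  shows "smooth_on S (tensor_bracket \<omega> A B)"
  unfolding tensor_bracket_def[abs_def]
  by (intro smooth_on_sum smooth_on_mult smooth_on_pderiv_at assms)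

section \<open>Brackets with a function corrected by multiples of shifted constraints\<close>

lemma pderiv_at_diff_sum_mult:
  assumes "A differentiable (at z)" "\<And>\<beta>. g \<beta> differentiable (at z)" "\<And>\<beta>. \<Phi> \<beta> differentiable (at z)"
  shows "pderiv_at i (\<lambda>w. A w - (\<Sum>\<beta>\<in>I. g \<beta> w * (\<Phi> \<beta> w - k \<beta>))) z =
    pderiv_at i A z - (\<Sum>\<beta>\<in>I. g \<beta> z * pderiv_at i (\<Phi> \<beta>) z + (\<Phi> \<beta> z - k \<beta>) * pderiv_at i (g \<beta>) z)"
proof -
  let ?D = "\<lambda>F. frechet_derivative F (at z)"
  have D: "(F has_derivative ?D F) (at z)" if "F differentiable (at z)" for F :: "real^'a \<Rightarrow> real"
    using that frechet_derivative_works by blast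
  have "((\<lambda>w. A w - (\<Sum>\<beta>\<in>I. g \<beta> w * (\<Phi> \<beta> w - k \<beta>))) has_derivative
      (\<lambda>h. ?D A h - (\<Sum>\<beta>\<in>I. g \<beta> z * (?D (\<Phi> \<beta>) h - 0) + ?D (g \<beta>) h * (\<Phi> \<beta> z - k \<beta>)))) (at z)"
    by (intro has_derivative_diff has_derivative_sum has_derivative_mult has_derivative_const D assms)
  from pderiv_at_eq[OF this] show ?thesis
    by (simp add: pderiv_at_def mult.commute)
qed

text \<open>The bracket is a derivation in each slot, and the constants \<open>k\<close> drop out of
  the derivatives. The corrected function has the shape of Dirac's starred variable; where
  \<open>\<Phi>\<close> equals \<open>k\<close>, the terms that differentiate the coefficients
  \<open>g\<close> disappear.\<close>

lemma tensor_bracket_diff_sum_mult_right: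
  assumes "A differentiable (at z)" "\<And>\<beta>. g \<beta> differentiable (at z)" "\<And>\<beta>. \<Phi> \<beta> differentiable (at z)"
  shows "tensor_bracket \<omega> X (\<lambda>w. A w - (\<Sum>\<beta>\<in>I. g \<beta> w * (\<Phi> \<beta> w - k \<beta>))) z =
    tensor_bracket \<omega> X A z
    - (\<Sum>\<beta>\<in>I. g \<beta> z * tensor_bracket \<omega> X (\<Phi> \<beta>) z + (\<Phi> \<beta> z - k \<beta>) * tensor_bracket \<omega> X (g \<beta>) z)"
proof -
  \<comment> \<open>Once the bracket is written as a contraction with the fixed vector
    \<open>v\<close>, only this rearrangement of finite sums remains.\<close>
  have *: "(\<Sum>j\<in>UNIV. t j * (u j - (\<Sum>\<beta>\<in>I. a \<beta> * p \<beta> j + b \<beta> * q \<beta> j)))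
      = (\<Sum>j\<in>UNIV. t j * u j) - (\<Sum>\<beta>\<in>I. a \<beta> * (\<Sum>j\<in>UNIV. t j * p \<beta> j) + b \<beta> * (\<Sum>j\<in>UNIV. t j * q \<beta> j))"
    for t u :: "'a \<Rightarrow> real" and a b :: "'b \<Rightarrow> real" and p q
    unfolding right_diff_distrib sum_subtractf sum_distrib_left sum.distrib[symmetric]
    by (subst sum.swap) (simp add: algebra_simps)
  define v where "v j = tensor_bracket \<omega> X (coord j) z" for j
  have v: "tensor_bracket \<omega> X F z = (\<Sum>j\<in>UNIV. v j * pderiv_at j F z)" for F
    unfolding v_def by (rule tensor_bracket_right_expansion)
  show ?thesis
    unfolding v pderiv_at_diff_sum_mult[OF assms] by (rule *)
qed

lemma tensor_bracket_diff_sum_mult_left: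
  assumes "A differentiable (at z)" "\<And>\<beta>. g \<beta> differentiable (at z)" "\<And>\<beta>. \<Phi> \<beta> differentiable (at z)"
  shows "tensor_bracket \<omega> (\<lambda>w. A w - (\<Sum>\<beta>\<in>I. g \<beta> w * (\<Phi> \<beta> w - k \<beta>))) X z =
    tensor_bracket \<omega> A X z
    - (\<Sum>\<beta>\<in>I. g \<beta> z * tensor_bracket \<omega> (\<Phi> \<beta>) X z + (\<Phi> \<beta> z - k \<beta>) * tensor_bracket \<omega> (g \<beta>) X z)"
proof -
  have *: "(\<Sum>j\<in>UNIV. (u j - (\<Sum>\<beta>\<in>I. a \<beta> * p \<beta> j + b \<beta> * q \<beta> j)) * t j)
      = (\<Sum>j\<in>UNIV. u j * t j) - (\<Sum>\<beta>\<in>I. a \<beta> * (\<Sum>j\<in>UNIV. p \<beta> j * t j) + b \<beta> * (\<Sum>j\<in>UNIV. q \<beta> j * t j))"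
    for t u :: "'a \<Rightarrow> real" and a b :: "'b \<Rightarrow> real" and p q
    unfolding left_diff_distrib sum_subtractf sum_distrib_left sum_distrib_right sum.distrib[symmetric]
    by (subst sum.swap) (simp add: algebra_simps)
  define v where "v j = tensor_bracket \<omega> (coord j) X z" for j
  have v: "tensor_bracket \<omega> F X z = (\<Sum>j\<in>UNIV. pderiv_at j F z * v j)" for F
    unfolding v_def by (rule tensor_bracket_left_expansion)
  show ?thesis
    unfolding v pderiv_at_diff_sum_mult[OF assms] by (rule *)
qed

section \<open>The Jacobi identity, from tensor components to arbitrary functions\<close>

lemma sum_rotate3:
  "(\<Sum>j\<in>J. \<Sum>k\<in>K. \<Sum>i\<in>I. F i j k) = (\<Sum>i\<in>I. \<Sum>j\<in>J. \<Sum>k\<in>K. F i j k)"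
proof -
  have "(\<Sum>j\<in>J. \<Sum>k\<in>K. \<Sum>i\<in>I. F i j k) = (\<Sum>j\<in>J. \<Sum>i\<in>I. \<Sum>k\<in>K. F i j k)"
    by (intro sum.cong refl sum.swap)
  also have "\<dots> = (\<Sum>i\<in>I. \<Sum>j\<in>J. \<Sum>k\<in>K. F i j k)"
    by (rule sum.swap)
  finally show ?thesis .
qed

text \<open>Here \<open>v X\<close> is the vector field of the bracket with \<open>X\<close> in the
  left slot, and \<open>H X\<close> is the Hessian form of \<open>X\<close> at \<open>z\<close>. The
  product rule for {B,C} yields two Hessian terms and one with derivatives of
  \<open>\<omega>\<close>. The minus sign comes from antisymmetry, which turns the contraction of
  \<open>\<omega>\<close> with the differential of \<open>C\<close> on the right into
  \<open>- v C\<close>.\<close>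

lemma tensor_bracket_tensor_bracket:
  assumes "open S" "z \<in> S" "\<And>i j. smooth_on S (\<lambda>z. \<omega> z $ i $ j)"
    and anti: "\<And>i j. \<omega> z $ i $ j = - \<omega> z $ j $ i"
    and "smooth_on S B" "smooth_on S C"
  defines "v X p \<equiv> tensor_bracket \<omega> X (coord p) z"
    and "H X u w \<equiv> \<Sum>p\<in>UNIV. \<Sum>j\<in>UNIV. u p * pderiv_at p (pderiv_at j X) z * w j"
  shows "tensor_bracket \<omega> A (tensor_bracket \<omega> B C) z =
    H C (v A) (v B) - H B (v A) (v C)
    + (\<Sum>i\<in>UNIV. \<Sum>j\<in>UNIV. \<Sum>k\<in>UNIV. pderiv_at i A z * pderiv_at j B z * pderiv_at k C z *
        (\<Sum>p\<in>UNIV. \<omega> z $ i $ p * pderiv_at p (\<lambda>w. \<omega> w $ j $ k) z))"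
proof -
  note diff = smooth_on_differentiable[OF _ assms(2)]
  have v: "v X p = (\<Sum>i\<in>UNIV. pderiv_at i X z * \<omega> z $ i $ p)" for X p
    unfolding v_def by (subst tensor_bracket_left_expansion) (simp add: tensor_bracket_coord_coord)
  have v': "- v X p = (\<Sum>i\<in>UNIV. \<omega> z $ p $ i * pderiv_at i X z)" for X p
    unfolding v sum_negf[symmetric] by (intro sum.cong refl) (subst anti, simp)
  have "pderiv_at p (tensor_bracket \<omega> B C) z =
      (\<Sum>j\<in>UNIV. \<Sum>k\<in>UNIV. pderiv_at j B z * \<omega> z $ j $ k * pderiv_at p (pderiv_at k C) z
        + pderiv_at p (pderiv_at j B) z * (\<omega> z $ j $ k * pderiv_at k C z)
        + pderiv_at j B z * pderiv_at k C z * pderiv_at p (\<lambda>w. \<omega> w $ j $ k) z)" for p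
    unfolding tensor_bracket_def[abs_def]
    using assms(3,5,6)
    by (simp add: pderiv_at_sum pderiv_at_mult diff smooth_on_pderiv_at smooth_on_sum smooth_on_mult assms(1) algebra_simps)
  also have "\<dots> p = (\<Sum>k\<in>UNIV. pderiv_at p (pderiv_at k C) z * v B k)
      - (\<Sum>j\<in>UNIV. pderiv_at p (pderiv_at j B) z * v C j)
      + (\<Sum>j\<in>UNIV. \<Sum>k\<in>UNIV. pderiv_at j B z * pderiv_at k C z * pderiv_at p (\<lambda>w. \<omega> w $ j $ k) z)" for p
  proof -
    have "(\<Sum>j\<in>UNIV. \<Sum>k\<in>UNIV. pderiv_at j B z * \<omega> z $ j $ k * pderiv_at p (pderiv_at k C) z)
        = (\<Sum>k\<in>UNIV. pderiv_at p (pderiv_at k C) z * v B k)"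
      unfolding v by (subst sum.swap) (simp add: sum_distrib_left mult.commute mult.left_commute)
    moreover have "(\<Sum>j\<in>UNIV. \<Sum>k\<in>UNIV. pderiv_at p (pderiv_at j B) z * (\<omega> z $ j $ k * pderiv_at k C z))
        = - (\<Sum>j\<in>UNIV. pderiv_at p (pderiv_at j B) z * v C j)"
      unfolding sum_negf[symmetric] mult_minus_right[symmetric] v' by (simp add: sum_distrib_left)
    ultimately show ?thesis by (simp add: sum.distrib)
  qed
  finally have *: "pderiv_at p (tensor_bracket \<omega> B C) z = \<dots> p" for p .
  have "tensor_bracket \<omega> A (tensor_bracket \<omega> B C) z = (\<Sum>p\<in>UNIV. v A p * pderiv_at p (tensor_bracket \<omega> B C) z)"
    unfolding v_def by (rule tensor_bracket_right_expansion)
  also have "\<dots> = H C (v A) (v B) - H B (v A) (v C) + (\<Sum>p\<in>UNIV. v A p *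
      (\<Sum>j\<in>UNIV. \<Sum>k\<in>UNIV. pderiv_at j B z * pderiv_at k C z * pderiv_at p (\<lambda>w. \<omega> w $ j $ k) z))"
    unfolding * H_def
    by (simp add: sum.distrib sum_subtractf distrib_left right_diff_distrib sum_distrib_left mult.assoc)
  also have "(\<Sum>p\<in>UNIV. v A p *
      (\<Sum>j\<in>UNIV. \<Sum>k\<in>UNIV. pderiv_at j B z * pderiv_at k C z * pderiv_at p (\<lambda>w. \<omega> w $ j $ k) z))
    = (\<Sum>p\<in>UNIV. \<Sum>i\<in>UNIV. \<Sum>j\<in>UNIV. \<Sum>k\<in>UNIV. pderiv_at i A z * pderiv_at j B z * pderiv_at k C z *
        (\<omega> z $ i $ p * pderiv_at p (\<lambda>w. \<omega> w $ j $ k) z))"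
    by (simp only: v sum_distrib_right) (simp add: sum_distrib_left mult.commute mult.left_commute)
  also have "\<dots> = (\<Sum>i\<in>UNIV. \<Sum>j\<in>UNIV. \<Sum>k\<in>UNIV. pderiv_at i A z * pderiv_at j B z * pderiv_at k C z *
        (\<Sum>p\<in>UNIV. \<omega> z $ i $ p * pderiv_at p (\<lambda>w. \<omega> w $ j $ k) z))"
  proof -
    have "(\<Sum>p\<in>UNIV. \<Sum>i\<in>UNIV. \<Sum>j\<in>UNIV. \<Sum>k\<in>UNIV. G p i j k) =
        (\<Sum>i\<in>UNIV. \<Sum>j\<in>UNIV. \<Sum>k\<in>UNIV. \<Sum>p\<in>UNIV. G p i j k)"
      for G :: "'a \<Rightarrow> 'a \<Rightarrow> 'a \<Rightarrow> 'a \<Rightarrow> real"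
      by (subst sum.swap) (intro sum.cong refl sum_rotate3[symmetric])
    then show ?thesis
      unfolding sum_distrib_left .
  qed
  finally show ?thesis .
qed

text \<open>In the cyclic sum the Hessian of each function occurs twice, with opposite signs and
  exchanged arguments, so symmetry of second derivatives cancels it. What remains is the
  componentwise Jacobi identity contracted with three differentials.\<close>

lemma tensor_bracket_jacobi:
  assumes "open S" "z \<in> S" "poisson_tensor_on S \<omega>"
    and "smooth_on S A" "smooth_on S B" "smooth_on S C"
  shows "tensor_bracket \<omega> A (tensor_bracket \<omega> B C) z
    + tensor_bracket \<omega> B (tensor_bracket \<omega> C A) z
    + tensor_bracket \<omega> C (tensor_bracket \<omega> A B) z = 0"
proof -
  have sm: "\<And>i j. smooth_on S (\<lambda>z. \<omega> z $ i $ j)"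
    and anti: "\<And>i j. \<omega> z $ i $ j = - \<omega> z $ j $ i"
    and jac: "\<And>i j k. (\<Sum>p\<in>UNIV. \<omega> z $ i $ p * pderiv_at p (\<lambda>w. \<omega> w $ j $ k) z
                + \<omega> z $ j $ p * pderiv_at p (\<lambda>w. \<omega> w $ k $ i) z
                + \<omega> z $ k $ p * pderiv_at p (\<lambda>w. \<omega> w $ i $ j) z) = 0"
    using assms(2,3) unfolding poisson_tensor_on_def by blast+
  note expand = tensor_bracket_tensor_bracket[OF assms(1,2) sm anti]
  define v where "v X p = tensor_bracket \<omega> X (coord p) z" for X p
  define H where "H X u w = (\<Sum>p\<in>UNIV. \<Sum>j\<in>UNIV. u p * pderiv_at p (pderiv_at j X) z * w j)" for X u w
  define J where "J i j k = (\<Sum>p\<in>UNIV. \<omega> z $ i $ p * pderiv_at p (\<lambda>w. \<omega> w $ j $ k) z)" for i j k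
  define T where "T A B C = (\<Sum>i\<in>UNIV. \<Sum>j\<in>UNIV. \<Sum>k\<in>UNIV.
    pderiv_at i A z * pderiv_at j B z * pderiv_at k C z * J i j k)" for A B C
  have sym: "H X u w = H X w u" if "smooth_on S X" for X u w
    unfolding H_def pderiv_at_commute[OF assms(1,2) that]
    by (subst sum.swap) (simp add: mult.commute mult.left_commute pderiv_at_commute[OF assms(1,2) that])
  \<comment> \<open>The summation indices are renamed so that all three cyclic terms carry the same
    product of differentials.\<close>
  have "T B C A = (\<Sum>i\<in>UNIV. \<Sum>j\<in>UNIV. \<Sum>k\<in>UNIV.
      pderiv_at i A z * pderiv_at j B z * pderiv_at k C z * J j k i)"
    unfolding T_def by (subst sum_rotate3) (simp add: mult.commute mult.left_commute)
  moreover have "T C A B = (\<Sum>i\<in>UNIV. \<Sum>j\<in>UNIV. \<Sum>k\<in>UNIV.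
      pderiv_at i A z * pderiv_at j B z * pderiv_at k C z * J k i j)"
    unfolding T_def by (subst sum_rotate3[symmetric]) (simp add: mult.commute mult.left_commute)
  ultimately have "T A B C + T B C A + T C A B = (\<Sum>i\<in>UNIV. \<Sum>j\<in>UNIV. \<Sum>k\<in>UNIV.
      pderiv_at i A z * pderiv_at j B z * pderiv_at k C z * (J i j k + J j k i + J k i j))"
    by (simp add: T_def sum.distrib distrib_left)
  also have "\<dots> = 0"
    using jac by (simp add: J_def sum.distrib)
  finally have "T A B C + T B C A + T C A B = 0" .
  then show ?thesis
    unfolding expand[OF assms(5,6)] expand[OF assms(6,4)] expand[OF assms(4,5)]
      v_def[symmetric] H_def[symmetric] J_def[symmetric] T_def[symmetric]
    using sym assms(4-6) by (smt (verit))
qed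

subsection \<open>The Dirac bracket\<close>

definition dirac_tensor ::
  "(real^'n::finite \<Rightarrow> real^'n^'n) \<Rightarrow> ('m::finite \<Rightarrow> real^'n \<Rightarrow> real) \<Rightarrow> real^'n \<Rightarrow> real^'n^'n" where
  "dirac_tensor \<omega> \<Phi> z = (\<chi> i j. dirac_bracket \<omega> \<Phi> (coord i) (coord j) z)"

text \<open>The Lagrange-type coefficient by which a multiple of the constraint with index
  \<open>\<beta>\<close> is later subtracted from \<open>A\<close> in
  \<open>starred\<close>.\<close>

definition dirac_multiplier ::
  "(real^'n::finite \<Rightarrow> real^'n^'n) \<Rightarrow> ('m::finite \<Rightarrow> real^'n \<Rightarrow> real) \<Rightarrow> (real^'n \<Rightarrow> real) \<Rightarrow> 'm \<Rightarrow> real^'n \<Rightarrow> real" where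
  "dirac_multiplier \<omega> \<Phi> A \<beta> z =
     (\<Sum>\<alpha>\<in>UNIV. tensor_bracket \<omega> A (\<Phi> \<alpha>) z * matrix_inv (constraint_matrix \<omega> \<Phi> z) $ \<alpha> $ \<beta>)"

lemma dirac_bracket_multiplier:
  "dirac_bracket \<omega> \<Phi> A B z = tensor_bracket \<omega> A B z
    - (\<Sum>\<beta>\<in>UNIV. dirac_multiplier \<omega> \<Phi> A \<beta> z * tensor_bracket \<omega> (\<Phi> \<beta>) B z)"
  unfolding dirac_bracket_def dirac_multiplier_def sum_distrib_right
  by (subst sum.swap) (rule refl)

lemma dirac_multiplier_expansion:
  "dirac_multiplier \<omega> \<Phi> A \<beta> z = (\<Sum>i\<in>UNIV. pderiv_at i A z * dirac_multiplier \<omega> \<Phi> (coord i) \<beta> z)"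
proof -
  define v where "v i \<alpha> = tensor_bracket \<omega> (coord i) (\<Phi> \<alpha>) z" for i \<alpha>
  have v: "tensor_bracket \<omega> A (\<Phi> \<alpha>) z = (\<Sum>i\<in>UNIV. pderiv_at i A z * v i \<alpha>)" for \<alpha>
    unfolding v_def by (rule tensor_bracket_left_expansion)
  show ?thesis
    unfolding dirac_multiplier_def v v_def[symmetric] sum_distrib_left sum_distrib_right
    by (subst sum.swap) (simp add: mult.assoc)
qed

lemma dirac_bracket_left_expansion:
  "dirac_bracket \<omega> \<Phi> A B z = (\<Sum>i\<in>UNIV. pderiv_at i A z * dirac_bracket \<omega> \<Phi> (coord i) B z)"
proof -
  define v where "v i = tensor_bracket \<omega> (coord i) B z" for i
  define c where "c i \<beta> = dirac_multiplier \<omega> \<Phi> (coord i) \<beta> z" for i \<beta>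
  have v: "tensor_bracket \<omega> A B z = (\<Sum>i\<in>UNIV. pderiv_at i A z * v i)"
    unfolding v_def by (rule tensor_bracket_left_expansion)
  have c: "dirac_multiplier \<omega> \<Phi> A \<beta> z = (\<Sum>i\<in>UNIV. pderiv_at i A z * c i \<beta>)" for \<beta>
    unfolding c_def by (rule dirac_multiplier_expansion)
  show ?thesis
    unfolding dirac_bracket_multiplier v c v_def[symmetric] c_def[symmetric]
      right_diff_distrib sum_subtractf sum_distrib_left sum_distrib_right
    by (subst (2) sum.swap) (simp add: mult.assoc)
qed

lemma dirac_bracket_right_expansion:
  "dirac_bracket \<omega> \<Phi> A B z = (\<Sum>j\<in>UNIV. dirac_bracket \<omega> \<Phi> A (coord j) z * pderiv_at j B z)"
proof -
  define v where "v X j = tensor_bracket \<omega> X (coord j) z" for X j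
  have v: "tensor_bracket \<omega> X B z = (\<Sum>j\<in>UNIV. v X j * pderiv_at j B z)" for X
    unfolding v_def by (rule tensor_bracket_right_expansion)
  show ?thesis
    unfolding dirac_bracket_multiplier v v_def[symmetric]
      left_diff_distrib sum_subtractf sum_distrib_left sum_distrib_right
    by (subst (2) sum.swap) (simp add: mult.assoc)
qed

text \<open>The Dirac bracket is of first order in each slot, so its values on coordinate functions
  determine it. The lemmas on tensor brackets thereby become available for it.\<close>

lemma dirac_bracket_tensor:
  "dirac_bracket \<omega> \<Phi> A B z = tensor_bracket (dirac_tensor \<omega> \<Phi>) A B z"
proof -
  define d where "d i j = dirac_bracket \<omega> \<Phi> (coord i) (coord j) z" for i j
  define e where "e i = dirac_bracket \<omega> \<Phi> (coord i) B z" for i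
  have e: "e i = (\<Sum>j\<in>UNIV. d i j * pderiv_at j B z)" for i
    unfolding e_def d_def by (rule dirac_bracket_right_expansion)
  have "dirac_bracket \<omega> \<Phi> A B z = (\<Sum>i\<in>UNIV. pderiv_at i A z * e i)"
    unfolding e_def by (rule dirac_bracket_left_expansion)
  then show ?thesis
    by (simp add: e tensor_bracket_def dirac_tensor_def d_def[symmetric] sum_distrib_left mult.assoc)
qed

text \<open>With a constraint in the right slot, the last factor of the correction is a column of
  the constraint matrix. The inverse contracts with it to a Kronecker delta, so the correction
  equals the whole bracket.\<close>

lemma dirac_bracket_constraint:
  assumes "invertible (constraint_matrix \<omega> \<Phi> z)"
  shows "dirac_bracket \<omega> \<Phi> A (\<Phi> \<gamma>) z = 0"
proof -
  let ?C = "constraint_matrix \<omega> \<Phi> z"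
  have inv: "matrix_inv ?C ** ?C = mat 1"
    using assms unfolding invertible_def matrix_inv_def by (rule someI2_ex) auto
  have "(\<Sum>\<beta>\<in>UNIV. matrix_inv ?C $ \<alpha> $ \<beta> * tensor_bracket \<omega> (\<Phi> \<beta>) (\<Phi> \<gamma>) z) = (if \<alpha> = \<gamma> then 1 else 0)" for \<alpha>
  proof -
    have "(matrix_inv ?C ** ?C) $ \<alpha> $ \<gamma> = (if \<alpha> = \<gamma> then 1 else 0)"
      unfolding inv by (simp add: mat_def)
    then show ?thesis
      by (simp add: matrix_matrix_mult_def constraint_matrix_def)
  qed
  then have "(\<Sum>\<alpha>\<in>UNIV. \<Sum>\<beta>\<in>UNIV. tensor_bracket \<omega> A (\<Phi> \<alpha>) z * matrix_inv ?C $ \<alpha> $ \<beta>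
      * tensor_bracket \<omega> (\<Phi> \<beta>) (\<Phi> \<gamma>) z) = tensor_bracket \<omega> A (\<Phi> \<gamma>) z"
    by (simp add: mult.assoc sum_distrib_left[symmetric] if_distrib[of "\<lambda>x. _ * x"] sum.delta cong: if_cong)
  then show ?thesis
    by (simp add: dirac_bracket_def)
qed

section \<open>Second class constraints in Dirac's terminology: starred variables and the Poisson
  property\<close>

locale second_class_constraints =
  fixes W :: "(real^'n::finite) set"
    and \<omega> :: "real^'n \<Rightarrow> real^'n^'n"
    and \<Phi> :: "'m::finite \<Rightarrow> real^'n \<Rightarrow> real"
  assumes open_W: "open W"
    and poisson: "poisson_tensor_on W \<omega>"
    and smooth_constraint: "smooth_on W (\<Phi> \<alpha>)"
    and invertible_constraint_matrix: "z \<in> W \<Longrightarrow> invertible (constraint_matrix \<omega> \<Phi> z)"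
begin

lemma smooth_tensor: "smooth_on W (\<lambda>z. \<omega> z $ i $ j)"
  using poisson by (simp add: poisson_tensor_on_def)

lemma tensor_antisym: "z \<in> W \<Longrightarrow> \<omega> z $ i $ j = - \<omega> z $ j $ i"
  using poisson unfolding poisson_tensor_on_def by blast

lemma smooth_bracket:
  "smooth_on W A \<Longrightarrow> smooth_on W B \<Longrightarrow> smooth_on W (tensor_bracket \<omega> A B)"
  by (rule smooth_on_tensor_bracket[OF open_W smooth_tensor])

lemma smooth_multiplier:
  assumes "smooth_on W A"
  shows "smooth_on W (dirac_multiplier \<omega> \<Phi> A \<beta>)"
proof -
  have "smooth_on W (\<lambda>z. constraint_matrix \<omega> \<Phi> z $ \<alpha> $ \<beta>)" for \<alpha> \<beta>
    using smooth_bracket[OF smooth_constraint smooth_constraint]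
    by (simp add: constraint_matrix_def)
  then show ?thesis
    unfolding dirac_multiplier_def[abs_def]
    by (intro smooth_on_sum smooth_on_mult smooth_on_matrix_inv smooth_bracket open_W assms
        smooth_constraint invertible_constraint_matrix)
qed

lemma smooth_dirac_bracket:
  assumes "smooth_on W A" "smooth_on W B"
  shows "smooth_on W (dirac_bracket \<omega> \<Phi> A B)"
  unfolding dirac_bracket_multiplier[abs_def]
  by (intro smooth_on_diff smooth_on_sum smooth_on_mult smooth_multiplier smooth_bracket open_W
      smooth_constraint assms)

lemma smooth_dirac_tensor: "smooth_on W (\<lambda>z. dirac_tensor \<omega> \<Phi> z $ i $ j)"
  using smooth_dirac_bracket[OF smooth_on_coord smooth_on_coord] by (simp add: dirac_tensor_def)

text \<open>Dirac's starred variable: it agrees with \<open>A\<close> on the level set of \<open>\<Phi>\<close> through \<open>z\<^sub>0\<close>, and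
  its bracket with any function is there the Dirac bracket of \<open>A\<close>.\<close>

definition starred :: "real^'n \<Rightarrow> (real^'n \<Rightarrow> real) \<Rightarrow> real^'n \<Rightarrow> real" where
  "starred z\<^sub>0 A w = A w - (\<Sum>\<beta>\<in>UNIV. dirac_multiplier \<omega> \<Phi> A \<beta> w * (\<Phi> \<beta> w - \<Phi> \<beta> z\<^sub>0))"

lemma smooth_starred:
  assumes "smooth_on W A"
  shows "smooth_on W (starred z\<^sub>0 A)"
  unfolding starred_def[abs_def]
  by (intro smooth_on_diff smooth_on_sum smooth_on_mult smooth_multiplier smooth_on_const open_W
      smooth_constraint assms)

text \<open>Differentiating the constraint factors of the starred variable reproduces the Dirac
  correction exactly; differentiating the multipliers leaves terms that vanish at the base
  point.\<close>

lemma bracket_starred_left: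
  assumes "smooth_on W A" "z \<in> W"
  shows "tensor_bracket \<omega> (starred z\<^sub>0 A) X z = dirac_bracket \<omega> \<Phi> A X z
    - (\<Sum>\<beta>\<in>UNIV. (\<Phi> \<beta> z - \<Phi> \<beta> z\<^sub>0) * tensor_bracket \<omega> (dirac_multiplier \<omega> \<Phi> A \<beta>) X z)"
  unfolding starred_def[abs_def]
  by (subst tensor_bracket_diff_sum_mult_left)
    (simp_all add: dirac_bracket_multiplier sum.distrib smooth_on_differentiable[OF _ assms(2)]
      assms(1) smooth_multiplier smooth_constraint)

text \<open>In the Dirac bracket the terms that differentiate the constraints are zero by the
  Casimir property, so only the terms with differentiated multipliers are left.\<close>

lemma dirac_bracket_starred_right:
  assumes "smooth_on W B" "z \<in> W"
  shows "dirac_bracket \<omega> \<Phi> X (starred z\<^sub>0 B) z = dirac_bracket \<omega> \<Phi> X B z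
    - (\<Sum>\<beta>\<in>UNIV. (\<Phi> \<beta> z - \<Phi> \<beta> z\<^sub>0) * dirac_bracket \<omega> \<Phi> X (dirac_multiplier \<omega> \<Phi> B \<beta>) z)"
  unfolding starred_def[abs_def] dirac_bracket_tensor
  by (subst tensor_bracket_diff_sum_mult_right)
    (simp_all add: sum.distrib smooth_on_differentiable[OF _ assms(2)] assms(1) smooth_multiplier
      smooth_constraint dirac_bracket_tensor[symmetric]
      dirac_bracket_constraint[OF invertible_constraint_matrix[OF assms(2)]])

text \<open>The coefficients \<open>h\<close> must be smooth, and the identity must hold on all of
  \<open>W\<close>, because an outer bracket will differentiate it once more.\<close>

lemma bracket_starred_starred:
  assumes "smooth_on W A" "smooth_on W B"
  obtains h where "\<And>\<beta>. smooth_on W (h \<beta>)"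
    and "\<And>z. z \<in> W \<Longrightarrow> tensor_bracket \<omega> (starred z\<^sub>0 A) (starred z\<^sub>0 B) z =
      dirac_bracket \<omega> \<Phi> A B z - (\<Sum>\<beta>\<in>UNIV. h \<beta> z * (\<Phi> \<beta> z - \<Phi> \<beta> z\<^sub>0))"
proof
  \<comment> \<open>The first summand arises from starring \<open>B\<close> inside the Dirac
    bracket, the second from starring \<open>A\<close> in the original bracket.\<close>
  let ?h = "\<lambda>\<beta> z. dirac_bracket \<omega> \<Phi> A (dirac_multiplier \<omega> \<Phi> B \<beta>) z
    + tensor_bracket \<omega> (dirac_multiplier \<omega> \<Phi> A \<beta>) (starred z\<^sub>0 B) z"
  show "smooth_on W (?h \<beta>)" for \<beta>
    by (intro smooth_on_add smooth_dirac_bracket smooth_bracket smooth_multiplier smooth_starred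
        open_W assms)
  show "tensor_bracket \<omega> (starred z\<^sub>0 A) (starred z\<^sub>0 B) z =
      dirac_bracket \<omega> \<Phi> A B z - (\<Sum>\<beta>\<in>UNIV. ?h \<beta> z * (\<Phi> \<beta> z - \<Phi> \<beta> z\<^sub>0))" if "z \<in> W" for z
    unfolding bracket_starred_left[OF assms(1) that] dirac_bracket_starred_right[OF assms(2) that]
      diff_diff_eq sum.distrib[symmetric]
    by (intro arg_cong2[where f = "(-)"] sum.cong refl) (simp add: algebra_simps)
qed

text \<open>The base point is \<open>z\<close> itself. There the outer starred variable acts as the
  Dirac bracket with \<open>A\<close>. Applied to the remainder of the inner bracket, it gives zero:
  differentiated constraints vanish by the Casimir property, and the other terms keep a factor that
  is zero at \<open>z\<close>.\<close>

lemma bracket_starred_bracket_starred: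
  assumes "smooth_on W A" "smooth_on W B" "smooth_on W C" "z \<in> W"
  shows "tensor_bracket \<omega> (starred z A) (tensor_bracket \<omega> (starred z B) (starred z C)) z
    = dirac_bracket \<omega> \<Phi> A (dirac_bracket \<omega> \<Phi> B C) z"
proof -
  let ?D = "dirac_bracket \<omega> \<Phi>"
  obtain h where h: "\<And>\<beta>. smooth_on W (h \<beta>)"
    "\<And>w. w \<in> W \<Longrightarrow> tensor_bracket \<omega> (starred z B) (starred z C) w =
      ?D B C w - (\<Sum>\<beta>\<in>UNIV. h \<beta> w * (\<Phi> \<beta> w - \<Phi> \<beta> z))"
    using bracket_starred_starred[OF assms(2,3)] by blast
  have "tensor_bracket \<omega> (starred z A) (tensor_bracket \<omega> (starred z B) (starred z C)) z
      = ?D A (tensor_bracket \<omega> (starred z B) (starred z C)) z"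
    by (simp add: bracket_starred_left[OF assms(1,4)])
  also have "\<dots> = ?D A (\<lambda>w. ?D B C w - (\<Sum>\<beta>\<in>UNIV. h \<beta> w * (\<Phi> \<beta> w - \<Phi> \<beta> z))) z"
    unfolding dirac_bracket_tensor[of _ _ A]
    by (rule tensor_bracket_cong_right[OF open_W assms(4)]) (rule h(2))
  also have "\<dots> = ?D A (?D B C) z"
    unfolding dirac_bracket_tensor[of _ _ A]
    by (subst tensor_bracket_diff_sum_mult_right)
      (simp_all add: smooth_on_differentiable[OF _ assms(4)] h(1) smooth_constraint
        smooth_dirac_bracket assms dirac_bracket_tensor[symmetric]
        dirac_bracket_constraint[OF invertible_constraint_matrix[OF assms(4)]])
  finally show ?thesis .
qed

text \<open>At the base point the Dirac bracket is the original bracket of two starred variables, so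
  antisymmetry carries over without any computation with the inverse matrix.\<close>

lemma dirac_bracket_antisym:
  assumes "smooth_on W A" "smooth_on W B" "z \<in> W"
  shows "dirac_bracket \<omega> \<Phi> A B z = - dirac_bracket \<omega> \<Phi> B A z"
proof -
  have starred: "tensor_bracket \<omega> (starred z X) (starred z Y) z = dirac_bracket \<omega> \<Phi> X Y z"
    if "smooth_on W X" "smooth_on W Y" for X Y
    by (simp add: bracket_starred_left[OF that(1) assms(3)] dirac_bracket_starred_right[OF that(2) assms(3)])
  show ?thesis
    unfolding starred[OF assms(1,2), symmetric] starred[OF assms(2,1), symmetric]
    by (rule tensor_bracket_antisym) (rule tensor_antisym[OF assms(3)])
qed

lemma dirac_bracket_jacobi:
  assumes "smooth_on W A" "smooth_on W B" "smooth_on W C" "z \<in> W"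
  shows "dirac_bracket \<omega> \<Phi> A (dirac_bracket \<omega> \<Phi> B C) z
    + dirac_bracket \<omega> \<Phi> B (dirac_bracket \<omega> \<Phi> C A) z
    + dirac_bracket \<omega> \<Phi> C (dirac_bracket \<omega> \<Phi> A B) z = 0"
proof -
  have starred: "smooth_on W (starred z A)" "smooth_on W (starred z B)" "smooth_on W (starred z C)"
    by (rule smooth_starred; fact)+
  show ?thesis
    unfolding bracket_starred_bracket_starred[OF assms(1,2,3,4), symmetric]
      bracket_starred_bracket_starred[OF assms(2,3,1,4), symmetric]
      bracket_starred_bracket_starred[OF assms(3,1,2,4), symmetric]
    by (rule tensor_bracket_jacobi[OF open_W assms(4) poisson starred])
qed

text \<open>Coordinate functions are inserted into the Jacobi identity: the inner bracket is then a
  tensor component, and expanding the outer one gives the contraction with its derivatives.\<close>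

lemma poisson_dirac_tensor: "poisson_tensor_on W (dirac_tensor \<omega> \<Phi>)"
proof -
  let ?D = "dirac_tensor \<omega> \<Phi>"
  have D: "?D w $ i $ j = dirac_bracket \<omega> \<Phi> (coord i) (coord j) w" for i j w
    by (simp add: dirac_tensor_def)
  have "(\<Sum>p\<in>UNIV. ?D z $ i $ p * pderiv_at p (\<lambda>w. ?D w $ j $ k) z
                + ?D z $ j $ p * pderiv_at p (\<lambda>w. ?D w $ k $ i) z
                + ?D z $ k $ p * pderiv_at p (\<lambda>w. ?D w $ i $ j) z) = 0"
    if "z \<in> W" for z i j k
  proof -
    have "(\<Sum>p\<in>UNIV. ?D z $ i $ p * pderiv_at p (\<lambda>w. ?D w $ j $ k) z)
        = dirac_bracket \<omega> \<Phi> (coord i) (dirac_bracket \<omega> \<Phi> (coord j) (coord k)) z" for i j k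
      unfolding D by (rule dirac_bracket_right_expansion[symmetric])
    then show ?thesis
      using dirac_bracket_jacobi[OF smooth_on_coord smooth_on_coord smooth_on_coord that, of i j k]
      by (simp add: sum.distrib)
  qed
  moreover have "?D z $ i $ j = - ?D z $ j $ i" if "z \<in> W" for z i j
    unfolding D by (rule dirac_bracket_antisym[OF smooth_on_coord smooth_on_coord that])
  ultimately show ?thesis
    unfolding poisson_tensor_on_def using smooth_dirac_tensor by (intro conjI allI ballI)
qed

end

subsection \<open>Restriction to the graph\<close>

lemma sum_UNIV_Plus:
  fixes F :: "'m::finite + 'k::finite \<Rightarrow> real"
  shows "(\<Sum>p\<in>UNIV. F p) = (\<Sum>\<alpha>\<in>UNIV. F (Inl \<alpha>)) + (\<Sum>a\<in>UNIV. F (Inr a))"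
  using sum.Plus[of UNIV UNIV F] by (simp add: o_def)

lemma has_derivative_graph_point:
  fixes f :: "'m::finite \<Rightarrow> real^'k::finite \<Rightarrow> real"
  assumes "\<And>\<alpha>. f \<alpha> differentiable (at y)"
  shows "(graph_point f has_derivative
    (\<lambda>h. \<chi> i. case i of Inl \<alpha> \<Rightarrow> frechet_derivative (f \<alpha>) (at y) h | Inr a \<Rightarrow> h $ a)) (at y)"
proof -
  \<comment> \<open>Writing the case distinction as a sum over axis vectors lets the derivative
    rules for sums and scalar multiples apply.\<close>
  have expansion: "(\<chi> i. case i of Inl \<alpha> \<Rightarrow> u \<alpha> | Inr a \<Rightarrow> v $ a)
      = (\<Sum>\<alpha>\<in>UNIV. u \<alpha> *\<^sub>R axis (Inl \<alpha>) 1) + (\<Sum>a\<in>UNIV. v $ a *\<^sub>R axis (Inr a) 1)"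
    for u :: "'m \<Rightarrow> real" and v :: "real^'k"
  proof -
    have "(\<Sum>\<alpha>\<in>UNIV. u \<alpha> * (if i = Inl \<alpha> then 1 else 0)) + (\<Sum>a\<in>UNIV. v $ a * (if i = Inr a then 1 else 0))
      = (case i of Inl \<alpha> \<Rightarrow> u \<alpha> | Inr a \<Rightarrow> v $ a)" for i :: "'m + 'k"
      by (cases i) (simp_all add: if_distrib[of "\<lambda>x. _ * x"] sum.delta cong: if_cong)
    then show ?thesis
      by (simp add: vec_eq_iff axis_def)
  qed
  have "(f \<alpha> has_derivative frechet_derivative (f \<alpha>) (at y)) (at y)" for \<alpha>
    using assms frechet_derivative_works by blast
  then show ?thesis
    unfolding graph_point_def[abs_def] expansion
    by (intro has_derivative_add has_derivative_sum has_derivative_scaleR_left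
        bounded_linear_imp_has_derivative[OF bounded_linear_vec_nth])
qed

text \<open>The derivative of the graph map along axis \<open>a\<close> has component 1 at
  \<open>Inr a\<close>, component \<open>pderiv_at a (f \<alpha>) y\<close> at each
  \<open>Inl \<alpha>\<close>, and 0 at the other \<open>Inr\<close> indices.\<close>

lemma
  assumes "\<And>\<alpha>. f \<alpha> differentiable (at y)" "F differentiable (at (graph_point f y))"
  shows differentiable_graph_point: "(\<lambda>y. F (graph_point f y)) differentiable (at y)"
    and pderiv_at_graph_point: "pderiv_at a (\<lambda>y. F (graph_point f y)) y =
      pderiv_at (Inr a) F (graph_point f y)
      + (\<Sum>\<alpha>\<in>UNIV. pderiv_at (Inl \<alpha>) F (graph_point f y) * pderiv_at a (f \<alpha>) y)"
proof -
  note D = diff_chain_at[OF has_derivative_graph_point[OF assms(1)] has_derivative_pderiv_at[OF assms(2)],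
    unfolded o_def]
  show "(\<lambda>y. F (graph_point f y)) differentiable (at y)"
    using D unfolding differentiable_def by blast
  have "(\<Sum>i\<in>UNIV. axis a (1::real) $ i * pderiv_at (Inr i) F (graph_point f y)) = pderiv_at (Inr a) F (graph_point f y)"
    by (simp add: axis_def if_distrib[of "\<lambda>x. x * _"] sum.delta cong: if_cong)
  with pderiv_at_eq[OF D]
  show "pderiv_at a (\<lambda>y. F (graph_point f y)) y = pderiv_at (Inr a) F (graph_point f y)
      + (\<Sum>\<alpha>\<in>UNIV. pderiv_at (Inl \<alpha>) F (graph_point f y) * pderiv_at a (f \<alpha>) y)"
    by (simp add: sum_UNIV_Plus mult.commute flip: pderiv_at_def)
qed

text \<open>By the chain rule, a partial derivative of the pullback is built from pullbacks of
  partial derivatives of \<open>F\<close>, covered by the induction hypothesis, and from derivatives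
  of the smooth \<open>f\<close>.\<close>

lemma Cr_on_graph_point:
  assumes "open V" "\<And>\<alpha>. smooth_on V (f \<alpha>)" "graph_point f ` V \<subseteq> W" "Cr_on r W F"
  shows "Cr_on r V (\<lambda>y. F (graph_point f y))"
  using assms(4)
proof (induction r arbitrary: F)
  case 0
  have "continuous_on V (graph_point f)"
  proof (rule continuous_at_imp_continuous_on, rule ballI)
    fix y assume "y \<in> V"
    then show "isCont (graph_point f) y"
      by (intro has_derivative_continuous[OF has_derivative_graph_point] smooth_on_differentiable[OF assms(2)])
  qed
  then show ?case
    using continuous_on_compose2[of W F V "graph_point f"] 0 assms(3) by simp
next
  case (Suc r)
  have F: "F differentiable (at (graph_point f y))" if "y \<in> V" for y
    using Suc.prems assms(3) that by auto
  note f = smooth_on_differentiable[OF assms(2)]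
  have "Cr_on r V (pderiv_at a (\<lambda>y. F (graph_point f y)))" for a
  proof (rule Cr_on_cong[OF assms(1)])
    have *: "Cr_on r V (\<lambda>y. pderiv_at p F (graph_point f y))" for p
      by (rule Suc.IH) (use Suc.prems in simp)
    have **: "Cr_on r V (pderiv_at a (f \<alpha>))" for \<alpha>
      using smooth_on_pderiv_at[OF assms(2)] by (simp add: smooth_on_def)
    have "Cr_on r V (\<lambda>y. \<Sum>\<alpha>\<in>I. pderiv_at (Inl \<alpha>) F (graph_point f y) * pderiv_at a (f \<alpha>) y)" for I
      by (induction I rule: infinite_finite_induct)
        (simp_all add: Cr_on_const Cr_on_add[OF assms(1)] Cr_on_mult[OF assms(1)] * **)
    then show "Cr_on r V (\<lambda>y. pderiv_at (Inr a) F (graph_point f y)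
        + (\<Sum>\<alpha>\<in>UNIV. pderiv_at (Inl \<alpha>) F (graph_point f y) * pderiv_at a (f \<alpha>) y))"
      by (intro Cr_on_add[OF assms(1)] *)
  qed (simp add: pderiv_at_graph_point[OF f F])
  then show ?case
    using differentiable_graph_point[OF f F] by simp
qed

lemma smooth_on_graph_point:
  assumes "open V" "\<And>\<alpha>. smooth_on V (f \<alpha>)" "graph_point f ` V \<subseteq> W" "smooth_on W F"
  shows "smooth_on V (\<lambda>y. F (graph_point f y))"
  using assms(4) Cr_on_graph_point[OF assms(1-3)] unfolding smooth_on_def by blast

section \<open>Tangency of the Dirac tensor to the graph, and the induced Poisson structure\<close>

locale graph_of_second_class_constraints =
  second_class_constraints W \<omega> \<Phi>
  for W :: "(real^('m::finite + 'k::finite)) set" and \<omega> and \<Phi> :: "'m \<Rightarrow> real^('m + 'k) \<Rightarrow> real" +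
  fixes V :: "(real^'k) set" and f :: "'m \<Rightarrow> real^'k \<Rightarrow> real"
  assumes open_V: "open V"
    and smooth_f: "smooth_on V (f \<alpha>)"
    and graph_subset: "graph_point f ` V \<subseteq> W"
    and constraint_graph: "y \<in> V \<Longrightarrow> \<Phi> \<alpha> (graph_point f y) = 0"
    and transversal: "y \<in> V \<Longrightarrow>
      det ((\<chi> \<alpha> \<beta>. pderiv_at (Inl \<beta>) (\<Phi> \<alpha>) (graph_point f y)) :: real^'m^'m) \<noteq> 0"
begin

abbreviation "D \<equiv> dirac_tensor \<omega> \<Phi>"

lemma graph_in_W: "y \<in> V \<Longrightarrow> graph_point f y \<in> W"
  using graph_subset by blast

lemma pderiv_at_pullback:
  assumes "smooth_on W F" "y \<in> V"
  shows "pderiv_at a (\<lambda>y. F (graph_point f y)) y = pderiv_at (Inr a) F (graph_point f y)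
    + (\<Sum>\<alpha>\<in>UNIV. pderiv_at (Inl \<alpha>) F (graph_point f y) * pderiv_at a (f \<alpha>) y)"
  by (intro pderiv_at_graph_point smooth_on_differentiable[OF smooth_f]
      smooth_on_differentiable[OF assms(1)] graph_in_W assms(2))

text \<open>The Casimir property says that row \<open>i\<close> of the Dirac tensor annihilates the
  differentials of the constraints. Eliminating their \<open>Inr\<close> derivatives leaves a
  homogeneous linear system for the difference \<open>x\<close> of the two sides, and its matrix
  \<open>J\<close> is nonsingular by \<open>transversal\<close>.\<close>

lemma dirac_tensor_tangent:
  assumes "y \<in> V"
  shows "D (graph_point f y) $ i $ Inl \<beta> =
    (\<Sum>a\<in>UNIV. D (graph_point f y) $ i $ Inr a * pderiv_at a (f \<beta>) y)"
proof -
  let ?z = "graph_point f y"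
  define J :: "real^'m^'m" where "J = (\<chi> \<alpha> \<beta>. pderiv_at (Inl \<beta>) (\<Phi> \<alpha>) ?z)"
  define x :: "real^'m" where
    "x = (\<chi> \<beta>. D ?z $ i $ Inl \<beta> - (\<Sum>a\<in>UNIV. D ?z $ i $ Inr a * pderiv_at a (f \<beta>) y))"
  have "(J *v x) $ \<alpha> = 0" for \<alpha>
  proof -
    \<comment> \<open>Implicit differentiation: the constraint vanishes identically along the
      graph.\<close>
    have tangent: "pderiv_at (Inr a) (\<Phi> \<alpha>) ?z = - (\<Sum>\<beta>\<in>UNIV. J $ \<alpha> $ \<beta> * pderiv_at a (f \<beta>) y)" for a
    proof -
      have "pderiv_at a (\<lambda>y. \<Phi> \<alpha> (graph_point f y)) y = pderiv_at a (\<lambda>y. 0) y"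
        by (rule pderiv_at_cong[OF open_V assms]) (rule constraint_graph)
      then show ?thesis
        by (simp add: pderiv_at_pullback[OF smooth_constraint assms] J_def)
    qed
    have "0 = dirac_bracket \<omega> \<Phi> (coord i) (\<Phi> \<alpha>) ?z"
      by (simp add: dirac_bracket_constraint invertible_constraint_matrix graph_in_W assms)
    also have "\<dots> = (\<Sum>p\<in>UNIV. D ?z $ i $ p * pderiv_at p (\<Phi> \<alpha>) ?z)"
      unfolding dirac_bracket_tensor by (rule tensor_bracket_coord_left)
    also have "\<dots> = (\<Sum>\<beta>\<in>UNIV. D ?z $ i $ Inl \<beta> * J $ \<alpha> $ \<beta>)
        - (\<Sum>a\<in>UNIV. \<Sum>\<beta>\<in>UNIV. D ?z $ i $ Inr a * (J $ \<alpha> $ \<beta> * pderiv_at a (f \<beta>) y))"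
      by (simp add: sum_UNIV_Plus tangent J_def sum_negf sum_distrib_left)
    also have "\<dots> = (J *v x) $ \<alpha>"
      by (subst sum.swap)
        (simp add: matrix_vector_mult_def x_def right_diff_distrib sum_subtractf sum_distrib_left
          mult.commute mult.left_commute)
    finally show ?thesis by simp
  qed
  then have "J *v x = 0"
    by (simp add: vec_eq_iff)
  moreover have "det J \<noteq> 0"
    unfolding J_def by (rule transversal[OF assms])
  ultimately have "x = 0"
    by (metis invertible_det_nz invertible_def matrix_left_invertible_ker)
  then have "x $ \<beta> = 0" by simp
  then show ?thesis by (simp add: x_def)
qed

text \<open>By tangency the \<open>Inl\<close> terms become \<open>Inr\<close> terms weighted by
  derivatives of \<open>f\<close>, which are exactly the extra terms of the chain rule. Both the
  Jacobi identity and the restriction formula on the graph rest on this.\<close>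

lemma dirac_tensor_pullback:
  assumes "smooth_on W F" "y \<in> V"
  shows "(\<Sum>p\<in>UNIV. D (graph_point f y) $ i $ p * pderiv_at p F (graph_point f y)) =
    (\<Sum>a\<in>UNIV. D (graph_point f y) $ i $ Inr a * pderiv_at a (\<lambda>y. F (graph_point f y)) y)"
proof -
  let ?z = "graph_point f y"
  have "(\<Sum>\<alpha>\<in>UNIV. D ?z $ i $ Inl \<alpha> * pderiv_at (Inl \<alpha>) F ?z) =
      (\<Sum>a\<in>UNIV. \<Sum>\<alpha>\<in>UNIV. D ?z $ i $ Inr a * (pderiv_at (Inl \<alpha>) F ?z * pderiv_at a (f \<alpha>) y))"
    unfolding dirac_tensor_tangent[OF assms(2)] sum_distrib_right
    by (subst sum.swap) (simp add: mult.commute mult.left_commute)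
  then show ?thesis
    by (simp add: sum_UNIV_Plus pderiv_at_pullback[OF assms] distrib_left sum.distrib sum_distrib_left)
qed

lemma induced_tensor_dirac_tensor:
  "induced_tensor \<omega> \<Phi> f y $ a $ b = D (graph_point f y) $ Inr a $ Inr b"
  by (simp add: induced_tensor_def dirac_tensor_def)

lemma dirac_tensor_antisym: "z \<in> W \<Longrightarrow> D z $ i $ j = - D z $ j $ i"
  using poisson_dirac_tensor unfolding poisson_tensor_on_def by blast

text \<open>The Jacobi identity of the Dirac tensor is taken at a graph point with three
  \<open>Inr\<close> indices. \<open>dirac_tensor_pullback\<close>, applied to its components as
  functions, cuts the sum over all \<open>p\<close> down to the \<open>Inr\<close> range.\<close>

lemma poisson_induced_tensor: "poisson_tensor_on V (induced_tensor \<omega> \<Phi> f)"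
proof -
  have "(\<Sum>p\<in>UNIV. D (graph_point f y) $ Inr a $ Inr p * pderiv_at p (\<lambda>y. D (graph_point f y) $ Inr b $ Inr c) y
      + D (graph_point f y) $ Inr b $ Inr p * pderiv_at p (\<lambda>y. D (graph_point f y) $ Inr c $ Inr a) y
      + D (graph_point f y) $ Inr c $ Inr p * pderiv_at p (\<lambda>y. D (graph_point f y) $ Inr a $ Inr b) y) = 0"
    if "y \<in> V" for y a b c
  proof -
    have "(\<Sum>p\<in>UNIV. D z $ i $ p * pderiv_at p (\<lambda>w. D w $ j $ k) z
                + D z $ j $ p * pderiv_at p (\<lambda>w. D w $ k $ i) z
                + D z $ k $ p * pderiv_at p (\<lambda>w. D w $ i $ j) z) = 0" if "z \<in> W" for z i j k
      using poisson_dirac_tensor that unfolding poisson_tensor_on_def by blast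
    from this[OF graph_in_W[OF that], of "Inr a" "Inr b" "Inr c"] show ?thesis
      by (simp only: sum.distrib dirac_tensor_pullback[OF smooth_dirac_tensor that])
  qed
  then show ?thesis
    unfolding poisson_tensor_on_def induced_tensor_dirac_tensor
    by (intro conjI allI ballI dirac_tensor_antisym[OF graph_in_W]
        smooth_on_graph_point[OF open_V smooth_f graph_subset smooth_dirac_tensor])
qed

lemma dirac_bracket_restriction:
  assumes "smooth_on W A" "smooth_on W B" "y \<in> V"
  shows "dirac_bracket \<omega> \<Phi> A B (graph_point f y) =
    induced_bracket \<omega> \<Phi> f (\<lambda>x. A (graph_point f x)) (\<lambda>x. B (graph_point f x)) y"
proof -
  let ?z = "graph_point f y"
  let ?A = "\<lambda>a. pderiv_at a (\<lambda>x. A (graph_point f x)) y" and ?B = "\<lambda>b. pderiv_at b (\<lambda>x. B (graph_point f x)) y"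
  have anti: "D ?z $ i $ j = - D ?z $ j $ i" for i j
    by (rule dirac_tensor_antisym[OF graph_in_W[OF assms(3)]])
  \<comment> \<open>\<open>dirac_tensor_pullback\<close> contracts the second index of the tensor;
    antisymmetry before and after it treats the first index.\<close>
  have A: "(\<Sum>i\<in>UNIV. pderiv_at i A ?z * D ?z $ i $ Inr b) = (\<Sum>a\<in>UNIV. ?A a * D ?z $ Inr a $ Inr b)" for b
  proof -
    have "(\<Sum>i\<in>UNIV. pderiv_at i A ?z * D ?z $ i $ Inr b) = - (\<Sum>i\<in>UNIV. D ?z $ Inr b $ i * pderiv_at i A ?z)"
      unfolding sum_negf[symmetric] by (intro sum.cong refl) (subst anti, simp)
    also have "\<dots> = - (\<Sum>a\<in>UNIV. D ?z $ Inr b $ Inr a * ?A a)"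
      by (simp only: dirac_tensor_pullback[OF assms(1,3)])
    also have "\<dots> = (\<Sum>a\<in>UNIV. ?A a * D ?z $ Inr a $ Inr b)"
      unfolding sum_negf[symmetric] by (intro sum.cong refl) (subst anti, simp)
    finally show ?thesis .
  qed
  have "dirac_bracket \<omega> \<Phi> A B ?z = (\<Sum>i\<in>UNIV. pderiv_at i A ?z * (\<Sum>j\<in>UNIV. D ?z $ i $ j * pderiv_at j B ?z))"
    by (simp add: dirac_bracket_tensor tensor_bracket_def sum_distrib_left mult.assoc)
  also have "\<dots> = (\<Sum>b\<in>UNIV. (\<Sum>i\<in>UNIV. pderiv_at i A ?z * D ?z $ i $ Inr b) * ?B b)"
    unfolding dirac_tensor_pullback[OF assms(2,3)] sum_distrib_left sum_distrib_right
    by (subst sum.swap) (simp add: mult.assoc)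
  also have "\<dots> = induced_bracket \<omega> \<Phi> f (\<lambda>x. A (graph_point f x)) (\<lambda>x. B (graph_point f x)) y"
    unfolding A induced_bracket_def tensor_bracket_def induced_tensor_dirac_tensor sum_distrib_right
    by (rule sum.swap)
  finally show ?thesis .
qed

lemma poisson_submanifold_graph:
  "poisson_submanifold W (dirac_bracket \<omega> \<Phi>) V f (induced_bracket \<omega> \<Phi> f)"
  unfolding poisson_submanifold_def poisson_bracket_on_def induced_bracket_def[symmetric]
\<comment> \<open>The tensors demanded by the two existential statements are left open here and
  become the Dirac tensor and the induced tensor through the next two claims.\<close>
proof (intro conjI allI impI ballI exI)
  show "poisson_tensor_on W D" "poisson_tensor_on V (induced_tensor \<omega> \<Phi> f)"
    by (rule poisson_dirac_tensor poisson_induced_tensor)+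
qed (simp_all add: graph_subset dirac_bracket_tensor[symmetric] induced_bracket_def[symmetric]
    dirac_bracket_restriction)

end

section \<open>Passage from \<open>M\<close> to the neighbourhood \<open>W\<close> of the constraint
  surface\<close>

lemma poisson_tensor_on_subset: "poisson_tensor_on S \<omega> \<Longrightarrow> T \<subseteq> S \<Longrightarrow> poisson_tensor_on T \<omega>"
  unfolding poisson_tensor_on_def by (meson smooth_on_subset subsetD)

text \<open>\<open>W\<close> is the neighbourhood of \<open>N\<close> in which the Dirac bracket is
  considered. The tensor and the constraints are restricted to it, and points of the graph inherit
  the vanishing of the constraints and transversality from membership in \<open>N\<close>.\<close>

theorem mainTheorem3:
  fixes M W N :: "(real^('m::finite + 'k::finite)) set"
    and \<omega> :: "real^('m + 'k) \<Rightarrow> real^('m + 'k)^('m + 'k)"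
    and \<Phi> :: "'m \<Rightarrow> real^('m + 'k) \<Rightarrow> real"
    and V :: "(real^'k) set"
    and f :: "'m \<Rightarrow> real^'k \<Rightarrow> real"
  assumes "open M"
    and "poisson_tensor_on M \<omega>"
    and "nondegenerate_on M \<omega>"
    and "\<And>\<alpha>. smooth_on M (\<Phi> \<alpha>)"
    and N_def: "N = {z\<in>M. \<forall>\<alpha>. \<Phi> \<alpha> z = 0}"
    and "functionally_independent_on N \<Phi>"
    and "\<And>z. z \<in> N \<Longrightarrow> det ((\<chi> \<alpha> \<beta>. pderiv_at (Inl \<beta>) (\<Phi> \<alpha>) z) :: real^'m^'m) \<noteq> 0"
    and "open V"
    and "\<And>\<alpha>. smooth_on V (f \<alpha>)"
    and "N = graph_point f ` V"
    and "\<And>z. z \<in> N \<Longrightarrow> invertible (constraint_matrix \<omega> \<Phi> z)"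
    and "open W" and "N \<subseteq> W" and "W \<subseteq> M"
    and "\<And>z. z \<in> W \<Longrightarrow> invertible (constraint_matrix \<omega> \<Phi> z)"
  shows "(\<forall>\<alpha>. casimir_on W (dirac_bracket \<omega> \<Phi>) (\<Phi> \<alpha>)) \<and>
         poisson_submanifold W (dirac_bracket \<omega> \<Phi>) V f (induced_bracket \<omega> \<Phi> f)"
proof -
  have "W \<subseteq> M" by fact
  interpret graph_of_second_class_constraints W \<omega> \<Phi> V f
  proof
    show "open W" "open V" by fact+
    show "poisson_tensor_on W \<omega>"
      using \<open>poisson_tensor_on M \<omega>\<close> \<open>W \<subseteq> M\<close> by (rule poisson_tensor_on_subset)
    show "smooth_on W (\<Phi> \<alpha>)" for \<alpha>
      using assms(4) \<open>W \<subseteq> M\<close> by (rule smooth_on_subset)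
    show "smooth_on V (f \<alpha>)" for \<alpha> by fact
    show "invertible (constraint_matrix \<omega> \<Phi> z)" if "z \<in> W" for z
      by (rule assms(15)[OF that])
    show "graph_point f ` V \<subseteq> W"
      using \<open>N = graph_point f ` V\<close> \<open>N \<subseteq> W\<close> by simp
    fix y assume "y \<in> V"
    then have "graph_point f y \<in> N"
      using \<open>N = graph_point f ` V\<close> by simp
    then show "\<Phi> \<alpha> (graph_point f y) = 0" for \<alpha>
      by (simp add: N_def)
    show "det ((\<chi> \<alpha> \<beta>. pderiv_at (Inl \<beta>) (\<Phi> \<alpha>) (graph_point f y)) :: real^'m^'m) \<noteq> 0"
      by (rule assms(7)[OF \<open>graph_point f y \<in> N\<close>])
  qed
  show ?thesis
    using poisson_submanifold_graph
    by (simp add: casimir_on_def dirac_bracket_constraint invertible_constraint_matrix)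
qed

end
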